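(* Let $a,b\ge1$ be integers, $\alpha,\beta\in[0,1)$, and set $\Delta a=\lfloor\beta/(1-\alpha)\rfloor$, $\Delta b=\lfloor\alpha/(1-\beta)\rfloor$. If $b\le\Delta b$ or $a\le\Delta a$, then $I(\alpha,\beta,R_{a,b})=0$. Suppose $b>\Delta b$ and $a>\Delta a$. If $\beta\le\alpha$ and $\lfloor\alpha/(1-\beta)\rfloor(1-\beta)\le\beta$, then $$I(\alpha,\beta,R_{a,b})=(1-\alpha)ab+((\alpha-\beta)\Delta b-\beta)a-\beta b-(1-\beta)\Delta a\Delta b+\beta\Delta a+\beta\Delta b+\beta-\max\{(1-\beta)\Delta b,(1-\alpha)\Delta a\}.$$ If $\beta\le\alpha$ and $\lfloor\alpha/(1-\beta)\rfloor(1-\beta)>\beta$, then $$I(\alpha,\beta,R_{a,b})=(1-\alpha)ab+\alpha\Delta b\,a-\beta b+\beta\Delta b+\min\{-\beta(\Delta b+1)a-(1-\beta)\Delta a\Delta b+\beta\Delta a+\beta-(1-\alpha)\Delta a,\ -\Delta b\,a\}.$$ If $\beta\ge\alpha$, then $I(\alpha,\beta,R_{a,b})=I(\beta,\alpha,R_{b,a})$.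
   Context: $\mathbb Z_+=\{0,1,2,\dots\}$, $R_{a,b}=([0,a-1]\times[0,b-1])\cap\mathbb Z_+^2$. For a zero-set $\mathcal Z$ (here $\mathcal Z=R_{a,b}$), $\mathrm{row}(x,A),\mathrm{col}(x,A)$ count points of $A$ on the horizontal/vertical line through $x$, $\mathcal T(A)=A\cup\{x\notin A:(\mathrm{row}(x,A),\mathrm{col}(x,A))\notin\mathcal Z\}$, and $A$ spans if $\bigcup_t\mathcal T^t(A)=\mathbb Z_+^2$. Large deviation rate: as $p\to0$ let integers $N,M\to\infty$ with $\log N\sim-\alpha\log p$, $\log M\sim-\beta\log p$; the initial set contains each point of $R_{N,M}$ independently with probability $p$; $I(\alpha,\beta,\mathcal Z)=\lim_{p\to0}\log P_p(\text{initial set spans})/\log p$. *)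

theory Defs
  imports Complex_Main "HOL-Library.Extended_Nat"
begin

definition ecard :: "'a set \<Rightarrow> enat" where
  "ecard S = (if finite S then enat (card S) else \<infinity>)"

definition rowcnt :: "nat \<times> nat \<Rightarrow> (nat \<times> nat) set \<Rightarrow> enat" where
  "rowcnt x A = ecard {y \<in> A. snd y = snd x}"

definition colcnt :: "nat \<times> nat \<Rightarrow> (nat \<times> nat) set \<Rightarrow> enat" where
  "colcnt x A = ecard {y \<in> A. fst y = fst x}"

text \<open>One step of the bootstrap operator T with zero-set Z (a subset of Z_+^2).
  An infinite count is never in Z.\<close>
definition Tstep :: "(nat \<times> nat) set \<Rightarrow> (nat \<times> nat) set \<Rightarrow> (nat \<times> nat) set" where
  "Tstep Z A = A \<union> {x. x \<notin> A \<and> (rowcnt x A, colcnt x A) \<notin> map_prod enat enat ` Z}"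

definition spans :: "(nat \<times> nat) set \<Rightarrow> (nat \<times> nat) set \<Rightarrow> bool" where
  "spans Z A \<longleftrightarrow> (\<Union>t. (Tstep Z ^^ t) A) = UNIV"

definition Rect :: "nat \<Rightarrow> nat \<Rightarrow> (nat \<times> nat) set" where
  "Rect a b = {(i, j). i < a \<and> j < b}"

text \<open>Probability that the p-random subset of R_{N,M} spans (explicit product measure).\<close>
definition span_prob :: "(nat \<times> nat) set \<Rightarrow> nat \<Rightarrow> nat \<Rightarrow> real \<Rightarrow> real" where
  "span_prob Z N M p =
     (\<Sum>S\<in>{S. S \<subseteq> Rect N M \<and> spans Z S}. p ^ card S * (1 - p) ^ (N * M - card S))"

text \<open>has_rate alpha beta Z v: I(alpha,beta,Z) = v, i.e. for every choice of integers
  N(p), M(p) tending to infinity as p -> 0+ with log N ~ -alpha log p and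
  log M ~ -beta log p, log P_p(span) / log p tends to v.\<close>
definition has_rate :: "real \<Rightarrow> real \<Rightarrow> (nat \<times> nat) set \<Rightarrow> real \<Rightarrow> bool" where
  "has_rate \<alpha> \<beta> Z v \<longleftrightarrow>
     (\<forall>N M :: real \<Rightarrow> nat.
        filterlim N at_top (at_right 0) \<and> filterlim M at_top (at_right 0) \<and>
        ((\<lambda>p. ln (real (N p)) / ln p) \<longlongrightarrow> - \<alpha>) (at_right 0) \<and>
        ((\<lambda>p. ln (real (M p)) / ln p) \<longlongrightarrow> - \<beta>) (at_right 0)
        \<longrightarrow> ((\<lambda>p. ln (span_prob Z (N p) (M p) p) / ln p) \<longlongrightarrow> v) (at_right 0))"

end

theory Submission
  imports Defs
begin

text \<open>
  A point set spans for the zero-set \<open>R\<^sub>a\<^sub>,\<^sub>b\<close> iff it can be peeled: remove a row with at least \<open>a\<close> points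
  and decrease \<open>b\<close>, or remove a column with at least \<open>b\<close> points and decrease \<open>a\<close>, until \<open>a\<close> or \<open>b\<close> is
  \<open>0\<close>. Among \<open>M\<close> rows of length \<open>N\<close> some row has \<open>i\<close> points with probability about
  \<open>min 1 (M (N p)^i)\<close>, so this step costs \<open>max 0 ((1 - \<alpha>) i - \<beta>)\<close> in the exponent, and symmetrically for
  columns. The points used in different steps are disjoint; hence the union bound and, for the converse,
  steps carried out in disjoint blocks show that the rate is the minimal total cost of a peeling. This
  minimum is the value of a two-dimensional dynamic program, which is solved by induction.
\<close>

section \<open>Random subsets of a finite set\<close>

text \<open>A filled row adds one to the count of every column, so the points off that row evolve as
  under \<open>Rect a (b - 1)\<close>; this is where peeling comes from. Since the dynamics is
  monotone, no removal can spoil a later one, and a peeling that gets stuck exhibits a proper set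
  that the dynamics never leaves. The upper bound needs no conditioning on earlier removals: the
  event about the rest involves no point of the removed line and is increasing, so it can be
  enlarged to the whole rectangle again and the recursion keeps the same side lengths. The
  hypotheses \<alpha>, \<beta> < 1 make N p and M p tend to 0, which is the regime where a line
  holds i points with probability of order (N p)^i or (M p)^i. The truncation of the costs at 0
  reflects that probabilities are at most 1, and it produces \<Delta>a and \<Delta>b: they are the
  largest levels at which a row or a column is free. The two bounds differ by constant factors and
  by a sum in place of a maximum; neither is visible after division by log p.\<close>

definition rprob :: "real \<Rightarrow> 'a set \<Rightarrow> ('a set \<Rightarrow> bool) \<Rightarrow> real" where
  "rprob p U P = (\<Sum>S\<in>{S. S \<subseteq> U \<and> P S}. p ^ card S * (1 - p) ^ (card U - card S))"

lemma rprob_cong: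
  assumes "\<And>S. S \<subseteq> U \<Longrightarrow> P S \<longleftrightarrow> Q S"
  shows "rprob p U P = rprob p U Q"
proof -
  have "{S. S \<subseteq> U \<and> P S} = {S. S \<subseteq> U \<and> Q S}" using assms by auto
  then show ?thesis by (simp add: rprob_def)
qed

lemma rprob_nonneg: "0 \<le> p \<Longrightarrow> p \<le> 1 \<Longrightarrow> 0 \<le> rprob p U P"
  by (simp add: rprob_def sum_nonneg)

lemma rprob_mono:
  assumes "finite U" "0 \<le> p" "p \<le> 1" "\<And>S. S \<subseteq> U \<Longrightarrow> P S \<Longrightarrow> Q S"
  shows "rprob p U P \<le> rprob p U Q"
  unfolding rprob_def using assms by (intro sum_mono2) auto

lemma rprob_disj_le:
  assumes "finite U" "0 \<le> p" "p \<le> 1"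
  shows "rprob p U (\<lambda>S. P S \<or> Q S) \<le> rprob p U P + rprob p U Q"
proof -
  have eq: "{S. S \<subseteq> U \<and> (P S \<or> Q S)} = {S. S \<subseteq> U \<and> P S} \<union> {S. S \<subseteq> U \<and> Q S}" by auto
  show ?thesis unfolding rprob_def eq using assms
    by (subst sum.union_inter[symmetric]) (auto intro!: sum_nonneg)
qed

lemma rprob_False [simp]: "rprob p U (\<lambda>S. False) = 0"
  by (simp add: rprob_def)

lemma rprob_Bex_le:
  assumes "finite U" "0 \<le> p" "p \<le> 1" "finite I"
  shows "rprob p U (\<lambda>S. \<exists>i\<in>I. P i S) \<le> (\<Sum>i\<in>I. rprob p U (P i))"
  using assms(4)
proof induction
  case (insert i I)
  have "rprob p U (\<lambda>S. \<exists>i\<in>insert i I. P i S) = rprob p U (\<lambda>S. P i S \<or> (\<exists>i\<in>I. P i S))"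
    by (rule rprob_cong) auto
  also have "\<dots> \<le> rprob p U (P i) + rprob p U (\<lambda>S. \<exists>i\<in>I. P i S)"
    by (rule rprob_disj_le[OF assms(1-3)])
  finally show ?case using insert by simp
qed simp

text \<open>Subsets of the union correspond to pairs \<open>(S \<inter> U, S \<inter> V)\<close>,
  and cardinalities add over disjoint sets, so the weight of the union is the product of the
  weights.\<close>

lemma rprob_indep:
  assumes "finite U" "finite V" "U \<inter> V = {}"
  shows "rprob p (U \<union> V) (\<lambda>S. P (S \<inter> U) \<and> Q (S \<inter> V)) = rprob p U P * rprob p V Q"
proof -
  let ?A = "{S. S \<subseteq> U \<and> P S}" and ?B = "{S. S \<subseteq> V \<and> Q S}"
  let ?C = "{S. S \<subseteq> U \<union> V \<and> P (S \<inter> U) \<and> Q (S \<inter> V)}"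
  have "rprob p U P * rprob p V Q =
     (\<Sum>(S, T)\<in>?A \<times> ?B. (p ^ card S * (1 - p) ^ (card U - card S)) *
        (p ^ card T * (1 - p) ^ (card V - card T)))"
    unfolding rprob_def by (simp add: sum_product sum.cartesian_product)
  also have "\<dots> = (\<Sum>S\<in>?C. p ^ card S * (1 - p) ^ (card (U \<union> V) - card S))"
  proof (rule sum.reindex_bij_witness[where i = "\<lambda>S. (S \<inter> U, S \<inter> V)" and j = "\<lambda>(S, T). S \<union> T"])
    fix x assume "x \<in> ?A \<times> ?B"
    then obtain S T where x: "x = (S, T)" "S \<subseteq> U" "P S" "T \<subseteq> V" "Q T" by auto
    have i: "(S \<union> T) \<inter> U = S" "(S \<union> T) \<inter> V = T" using x assms by auto
    show "(\<lambda>S. (S \<inter> U, S \<inter> V)) ((\<lambda>(S, T). S \<union> T) x) = x"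
      using i x by simp
    show "(case x of (S, T) \<Rightarrow> S \<union> T) \<in> ?C" using i x by auto
    have fin: "finite S" "finite T" using x assms finite_subset by blast+
    have "card (S \<union> T) = card S + card T" "card (U \<union> V) = card U + card V"
      using assms fin x by (auto intro!: card_Un_disjoint)
    \<comment> \<open>These bounds let the truncated subtraction in the exponent of
      \<open>1 - p\<close> split into two summands.\<close>
    moreover have "card S \<le> card U" "card T \<le> card V" using assms x by (auto intro: card_mono)
    ultimately have "card (U \<union> V) - card (S \<union> T) = (card U - card S) + (card V - card T)"
      and "card (S \<union> T) = card S + card T" by simp_all
    then show "p ^ card (case x of (S, T) \<Rightarrow> S \<union> T) *
      (1 - p) ^ (card (U \<union> V) - card (case x of (S, T) \<Rightarrow> S \<union> T)) =
      (case x of (S, T) \<Rightarrow> (p ^ card S * (1 - p) ^ (card U - card S)) *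
        (p ^ card T * (1 - p) ^ (card V - card T)))"
      using x by (simp only: prod.case power_add mult.assoc mult.left_commute)
  next
    fix S assume "S \<in> ?C"
    then show "(\<lambda>(S, T). S \<union> T) (S \<inter> U, S \<inter> V) = S" "(S \<inter> U, S \<inter> V) \<in> ?A \<times> ?B" by auto
  qed
  finally show ?thesis by (simp add: rprob_def)
qed

lemma rprob_True:
  assumes "finite U" shows "rprob p U (\<lambda>S. True) = 1"
  using assms
proof induction
  case empty
  show ?case by (simp add: rprob_def)
next
  case (insert x U)
  have "{S. S \<subseteq> {x}} = {{}, {x}}" by auto
  then have "rprob p {x} (\<lambda>S. True) = 1" by (simp add: rprob_def)
  then show ?case using rprob_indep[of "{x}" U p "\<lambda>_. True" "\<lambda>_. True"] insert by simp
qed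

lemma rprob_le_1: "finite U \<Longrightarrow> 0 \<le> p \<Longrightarrow> p \<le> 1 \<Longrightarrow> rprob p U P \<le> 1"
  using rprob_mono[of U p P "\<lambda>_. True"] by (simp add: rprob_True)

lemma rprob_Not:
  assumes "finite U" shows "rprob p U (\<lambda>S. \<not> P S) = 1 - rprob p U P"
proof -
  have eq: "{S. S \<subseteq> U \<and> True} = {S. S \<subseteq> U \<and> P S} \<union> {S. S \<subseteq> U \<and> \<not> P S}" by auto
  have "rprob p U (\<lambda>S. True) = rprob p U P + rprob p U (\<lambda>S. \<not> P S)"
    unfolding rprob_def eq using assms by (intro sum.union_disjoint) auto
  then show ?thesis by (simp add: rprob_True assms)
qed

lemma rprob_marginal:
  assumes "finite W" "U \<subseteq> W"
  shows "rprob p W (\<lambda>S. P (S \<inter> U)) = rprob p U P"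
  using rprob_indep[of U "W - U" p P "\<lambda>_. True"] assms
  by (simp add: finite_subset rprob_True Un_absorb1)

lemma rprob_indep_subsets:
  assumes "finite W" "U \<subseteq> W" "V \<subseteq> W" "U \<inter> V = {}"
  shows "rprob p W (\<lambda>S. P (S \<inter> U) \<and> Q (S \<inter> V)) = rprob p U P * rprob p V Q"
proof -
  have "rprob p W (\<lambda>S. P (S \<inter> U) \<and> Q (S \<inter> V)) =
      rprob p W (\<lambda>S. (\<lambda>T. P (T \<inter> U) \<and> Q (T \<inter> V)) (S \<inter> (U \<union> V)))"
    by (rule rprob_cong) (simp add: Int_assoc Int_absorb1 Int_absorb2)
  also have "\<dots> = rprob p (U \<union> V) (\<lambda>T. P (T \<inter> U) \<and> Q (T \<inter> V))"
    using assms by (intro rprob_marginal) auto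
  also have "\<dots> = rprob p U P * rprob p V Q"
    using assms by (intro rprob_indep) (auto intro: finite_subset)
  finally show ?thesis .
qed

lemma rprob_image:
  assumes "inj_on f U"
  shows "rprob p (f ` U) P = rprob p U (\<lambda>S. P (f ` S))"
proof -
  have inj: "inj_on (image f) {S. S \<subseteq> U \<and> P (f ` S)}"
    using inj_on_image_Pow[OF assms] by (rule inj_on_subset) auto
  have eq: "{S. S \<subseteq> f ` U \<and> P S} = image f ` {S. S \<subseteq> U \<and> P (f ` S)}"
    by (auto simp: subset_image_iff)
  have "rprob p (f ` U) P =
      (\<Sum>S\<in>{S. S \<subseteq> U \<and> P (f ` S)}. p ^ card (f ` S) * (1 - p) ^ (card (f ` U) - card (f ` S)))"
    unfolding rprob_def eq by (simp add: sum.reindex[OF inj])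
  also have "\<dots> = rprob p U (\<lambda>S. P (f ` S))"
    unfolding rprob_def using assms
    by (intro sum.cong) (auto simp: card_image inj_on_subset)
  finally show ?thesis .
qed

section \<open>Tails of the binomial distribution\<close>

lemma rprob_card_ge_le:
  assumes "finite X" "0 \<le> p" "p \<le> 1"
  shows "rprob p X (\<lambda>S. m \<le> card S) \<le> (real (card X) * p) ^ m"
proof -
  let ?I = "{T. T \<subseteq> X \<and> card T = m}"
  \<comment> \<open>Union bound over the m-subsets of \<open>X\<close>: each is contained in the
    random set with probability \<open>p ^ m\<close>, and there are at most
    \<open>card X ^ m\<close> of them.\<close>
  have "rprob p X (\<lambda>S. m \<le> card S) \<le> rprob p X (\<lambda>S. \<exists>T\<in>?I. T \<subseteq> S)"
  proof (rule rprob_mono[OF assms])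
    fix S assume S: "S \<subseteq> X" "m \<le> card S"
    then obtain T where "T \<subseteq> S" "card T = m" by (meson obtain_subset_with_card_n)
    then show "\<exists>T\<in>?I. T \<subseteq> S" using S by auto
  qed
  also have "\<dots> \<le> (\<Sum>T\<in>?I. rprob p X (\<lambda>S. T \<subseteq> S))"
    using assms by (intro rprob_Bex_le) auto
  also have "\<dots> = (\<Sum>T\<in>?I. p ^ m)"
  proof (rule sum.cong[OF refl])
    fix T assume T: "T \<in> ?I"
    have "rprob p X (\<lambda>S. T \<subseteq> S) = rprob p X (\<lambda>S. T \<subseteq> S \<inter> T)" by (rule rprob_cong) auto
    also have "\<dots> = rprob p T (\<lambda>S. T \<subseteq> S)" using rprob_marginal[of X T p "\<lambda>S. T \<subseteq> S"] assms T by auto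
    also have "{S. S \<subseteq> T \<and> T \<subseteq> S} = {T}" by auto
    then have "rprob p T (\<lambda>S. T \<subseteq> S) = p ^ m" using T by (simp add: rprob_def)
    finally show "rprob p X (\<lambda>S. T \<subseteq> S) = p ^ m" .
  qed
  also have "\<dots> = real (card X choose m) * p ^ m"
    using n_subsets[OF assms(1), of m] by simp
  also have "\<dots> \<le> real (card X) ^ m * p ^ m"
  proof (intro mult_right_mono)
    have "card X choose m \<le> card X ^ m"
      by (cases "m \<le> card X") (auto intro: binomial_le_pow simp: binomial_eq_0)
    then show "real (card X choose m) \<le> real (card X) ^ m"
      by (metis of_nat_le_iff of_nat_power)
  qed (use assms in simp)
  finally show ?thesis by (simp add: power_mult_distrib)
qed

text \<open>Only sets with exactly m points are counted. The binomial coefficient is at least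
  \<open>(n / m) ^ m\<close>, and by Bernoulli's inequality the absence of all other points costs at
  most a factor 2 as long as the expected number of points is at most 1/2.\<close>

lemma rprob_card_ge_ge:
  assumes "finite X" "0 \<le> p" "p \<le> 1" "m \<le> card X" "real (card X) * p \<le> 1 / 2"
  shows "(real (card X) * p / real m) ^ m / 2 \<le> rprob p X (\<lambda>S. m \<le> card S)"
proof -
  let ?n = "card X" and ?I = "{T. T \<subseteq> X \<and> card T = m}"
  have "1 / 2 \<le> 1 + real ?n * (- p)" using assms by simp
  also have "\<dots> \<le> (1 + - p) ^ ?n" using assms by (intro Bernoulli_inequality) simp
  also have "\<dots> \<le> (1 - p) ^ (?n - m)" using assms by (simp add: power_decreasing)
  finally have half: "1 / 2 \<le> (1 - p) ^ (?n - m)" .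
  have "(real ?n * p / real m) ^ m / 2 = (real ?n / real m) ^ m * p ^ m * (1 / 2)"
    by (simp add: power_mult_distrib power_divide)
  also have "\<dots> \<le> real (?n choose m) * p ^ m * (1 - p) ^ (?n - m)"
    using assms half binomial_ge_n_over_k_pow_k[OF assms(4), where 'a = real]
    by (intro mult_mono) auto
  also have "\<dots> = rprob p X (\<lambda>S. card S = m)"
    using n_subsets[OF assms(1), of m] by (simp add: rprob_def)
  also have "\<dots> \<le> rprob p X (\<lambda>S. m \<le> card S)" by (rule rprob_mono[OF assms(1-3)]) simp
  finally show ?thesis .
qed

section \<open>Spanning as successive removal of lines\<close>

text \<open>The two numbers are the thresholds still to be met. A removed row counts as full and
  gives one point to every column, so it lowers the column threshold and leaves the row threshold
  alone. Since \<open>card\<close> is 0 on infinite sets, the predicate has its intended meaning for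
  finite sets only.\<close>

fun peels :: "nat \<Rightarrow> nat \<Rightarrow> (nat \<times> nat) set \<Rightarrow> bool" where
  "peels 0 j A = True"
| "peels (Suc i) 0 A = True"
| "peels (Suc i) (Suc j) A =
    ((\<exists>y. Suc i \<le> card {x. (x, y) \<in> A} \<and> peels (Suc i) j (A - UNIV \<times> {y})) \<or>
     (\<exists>x. Suc j \<le> card {y. (x, y) \<in> A} \<and> peels i (Suc j) (A - {x} \<times> UNIV)))"

lemma peels_0_right [simp]: "peels i 0 A"
  by (cases i) auto

lemma finite_row: "finite A \<Longrightarrow> finite {x. (x, y) \<in> A}"
  by (rule finite_subset[of _ "fst ` A"]) force+

lemma finite_column: "finite A \<Longrightarrow> finite {y. (x, y) \<in> A}"
  by (rule finite_subset[of _ "snd ` A"]) force+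

text \<open>The same lines can be removed from the larger set. Finiteness of \<open>B\<close>
  prevents a line of \<open>B\<close> from being infinite, where \<open>card\<close> would drop to
  0.\<close>

lemma peels_mono:
  assumes "peels i j A" "A \<subseteq> B" "finite B"
  shows "peels i j B"
  using assms
proof (induction i j A arbitrary: B rule: peels.induct)
  case (3 i j A)
  have rows: "card {x. (x, y) \<in> A} \<le> card {x. (x, y) \<in> B}" for y
    using 3 by (intro card_mono finite_row) auto
  have cols: "card {y. (x, y) \<in> A} \<le> card {y. (x, y) \<in> B}" for x
    using 3 by (intro card_mono finite_column) auto
  from "3.prems"(1) consider
      y where "Suc i \<le> card {x. (x, y) \<in> A}" "peels (Suc i) j (A - UNIV \<times> {y})"
    | x where "Suc j \<le> card {y. (x, y) \<in> A}" "peels i (Suc j) (A - {x} \<times> UNIV)"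
    unfolding peels.simps by blast
  then show ?case
  proof cases
    case 1
    then have "peels (Suc i) j (B - UNIV \<times> {y})"
      using "3.IH"(1)[of y "B - UNIV \<times> {y}"] "3.prems"(2,3) by auto
    then show ?thesis using 1 rows[of y] unfolding peels.simps by (meson order_trans)
  next
    case 2
    then have "peels i (Suc j) (B - {x} \<times> UNIV)"
      using "3.IH"(2)[of x "B - {x} \<times> UNIV"] "3.prems"(2,3) by auto
    then show ?thesis using 2 cols[of x] unfolding peels.simps by (meson order_trans)
  qed
qed auto

lemma peels_swap: "peels i j A \<Longrightarrow> peels j i (prod.swap ` A)"
proof (induction i j A rule: peels.induct)
  case (3 i j A)
  have rows: "{y. (y, x) \<in> prod.swap ` A} = {y. (x, y) \<in> A}"
    and cols: "{x. (y, x) \<in> prod.swap ` A} = {x. (x, y) \<in> A}" for x y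
    by auto
  have diff: "prod.swap ` (A - UNIV \<times> {y}) = prod.swap ` A - {y} \<times> UNIV"
    "prod.swap ` (A - {x} \<times> UNIV) = prod.swap ` A - UNIV \<times> {x}" for x y
    by auto
  from "3.prems" consider
      y where "Suc i \<le> card {x. (x, y) \<in> A}" "peels (Suc i) j (A - UNIV \<times> {y})"
    | x where "Suc j \<le> card {y. (x, y) \<in> A}" "peels i (Suc j) (A - {x} \<times> UNIV)"
    unfolding peels.simps by blast
  then show ?case
  proof cases
    case 1
    then have "peels j (Suc i) (prod.swap ` A - {y} \<times> UNIV)"
      using "3.IH"(1)[of y] by (simp only: diff)
    then show ?thesis using 1 cols[of y] unfolding peels.simps by metis
  next
    case 2
    then have "peels (Suc j) i (prod.swap ` A - UNIV \<times> {x})"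
      using "3.IH"(2)[of x] by (simp only: diff)
    then show ?thesis using 2 rows[of x] unfolding peels.simps by metis
  qed
qed auto

lemma peels_swap_iff: "peels j i (prod.swap ` A) \<longleftrightarrow> peels i j A"
proof
  assume "peels j i (prod.swap ` A)"
  from peels_swap[OF this] show "peels i j A" by (simp add: image_image)
qed (rule peels_swap)

text \<open>The state of the dynamics once the rows \<open>R\<close> and columns \<open>C\<close>
  are full. With an empty last argument it is the union of these lines alone, so
  \<open>A - add_lines R C {}\<close> is what remains to be peeled.\<close>

definition add_lines :: "nat set \<Rightarrow> nat set \<Rightarrow> (nat \<times> nat) set \<Rightarrow> (nat \<times> nat) set" where
  "add_lines R C A = A \<union> UNIV \<times> R \<union> C \<times> UNIV"

lemma mem_Tstep_Rect:
  "z \<in> Tstep (Rect a b) A \<longleftrightarrow> z \<in> A \<or> enat a \<le> rowcnt z A \<or> enat b \<le> colcnt z A"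
proof -
  have "(r, c) \<in> map_prod enat enat ` Rect a b \<longleftrightarrow> r < enat a \<and> c < enat b" for r c
    by (cases r; cases c) (auto simp: Rect_def map_prod_def image_iff)
  then show ?thesis unfolding Tstep_def by (auto simp: not_less)
qed

section \<open>Monotonicity and iteration of the bootstrap operator\<close>

lemma ecard_mono: "A \<subseteq> B \<Longrightarrow> ecard A \<le> ecard B"
  by (auto simp: ecard_def intro: card_mono finite_subset)

lemma le_ecard:
  assumes "finite B" "B \<subseteq> A" "n \<le> card B" shows "enat n \<le> ecard A"
proof -
  have "enat n \<le> ecard B" using assms by (simp add: ecard_def)
  also have "\<dots> \<le> ecard A" by (rule ecard_mono[OF assms(2)])
  finally show ?thesis .
qed

lemma Tstep_mono:
  assumes "A \<subseteq> B" shows "Tstep (Rect a b) A \<subseteq> Tstep (Rect a b) B"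
proof
  fix z assume "z \<in> Tstep (Rect a b) A"
  moreover have "rowcnt z A \<le> rowcnt z B" "colcnt z A \<le> colcnt z B"
    using assms by (auto simp: rowcnt_def colcnt_def intro!: ecard_mono)
  ultimately show "z \<in> Tstep (Rect a b) B" using assms unfolding mem_Tstep_Rect
    by (auto intro: order_trans)
qed

lemma Tstep_funpow_mono: "A \<subseteq> B \<Longrightarrow> (Tstep (Rect a b) ^^ t) A \<subseteq> (Tstep (Rect a b) ^^ t) B"
proof (induction t)
  case (Suc t)
  then show ?case using Tstep_mono by simp
qed simp

lemma spans_mono:
  assumes "spans (Rect a b) A" "A \<subseteq> B" shows "spans (Rect a b) B"
proof -
  have "(\<Union>t. (Tstep (Rect a b) ^^ t) A) \<subseteq> (\<Union>t. (Tstep (Rect a b) ^^ t) B)"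
    using assms(2) by (intro UN_mono subset_refl Tstep_funpow_mono)
  then show ?thesis using assms(1) unfolding spans_def by (simp add: top.extremum_unique)
qed

lemma spans_TstepD:
  assumes "spans (Rect a b) (Tstep (Rect a b) A)" shows "spans (Rect a b) A"
proof -
  have "(\<Union>t. (Tstep (Rect a b) ^^ t) (Tstep (Rect a b) A)) \<subseteq> (\<Union>t. (Tstep (Rect a b) ^^ t) A)"
  proof (rule UN_least)
    fix t
    have "(Tstep (Rect a b) ^^ t) (Tstep (Rect a b) A) = (Tstep (Rect a b) ^^ Suc t) A"
      by (simp add: funpow_swap1)
    also have "\<dots> \<subseteq> (\<Union>t. (Tstep (Rect a b) ^^ t) A)" by (rule UN_upper) simp
    finally show "(Tstep (Rect a b) ^^ t) (Tstep (Rect a b) A) \<subseteq> (\<Union>t. (Tstep (Rect a b) ^^ t) A)" .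
  qed
  then show ?thesis using assms unfolding spans_def by (simp add: top.extremum_unique)
qed

lemma spans_if_Tstep_UNIV:
  assumes "Tstep (Rect a b) A = UNIV" shows "spans (Rect a b) A"
proof -
  have "(Tstep (Rect a b) ^^ 1) A \<subseteq> (\<Union>t. (Tstep (Rect a b) ^^ t) A)" by (rule UN_upper) simp
  then show ?thesis using assms unfolding spans_def by (simp add: top.extremum_unique)
qed

lemma not_spans_if_closed:
  assumes "A \<subseteq> D" "Tstep (Rect a b) D \<subseteq> D" "D \<noteq> UNIV"
  shows "\<not> spans (Rect a b) A"
proof -
  have "(Tstep (Rect a b) ^^ t) A \<subseteq> D" for t
  proof (induction t)
    case (Suc t)
    then show ?case using Tstep_mono[OF Suc, of a b] assms(2) by simp
  qed (use assms in simp)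
  then have "(\<Union>t. (Tstep (Rect a b) ^^ t) A) \<subseteq> D" by (rule UN_least)
  then show ?thesis using assms(3) unfolding spans_def by auto
qed

text \<open>The equations \<open>card C + i = a\<close> and \<open>card R + j = b\<close> say that
  the remaining thresholds count the lines not yet filled. A row with i residual points also meets
  the \<open>card C\<close> full columns, which makes a points in total, so one step fills it. When
  a threshold reaches 0, a columns or b rows are full and the next step fills the plane.\<close>

lemma peels_imp_spans:
  assumes "peels i j (A - add_lines R C {})" "finite A" "finite R" "finite C"
    and "card C + i = a" "card R + j = b"
  shows "spans (Rect a b) (add_lines R C A)"
  using assms
proof (induction i j "A - add_lines R C {}" arbitrary: R C rule: peels.induct)
  case (1 j)
  have "enat a \<le> rowcnt z (add_lines R C A)" for z unfolding rowcnt_def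
    by (rule le_ecard[of "C \<times> {snd z}"]) (use 1 in \<open>auto simp: add_lines_def card_cartesian_product\<close>)
  then show ?case by (intro spans_if_Tstep_UNIV) (auto simp: mem_Tstep_Rect)
next
  case (2 i)
  have "enat b \<le> colcnt z (add_lines R C A)" for z unfolding colcnt_def
    by (rule le_ecard[of "{fst z} \<times> R"]) (use 2 in \<open>auto simp: add_lines_def card_cartesian_product\<close>)
  then show ?case by (intro spans_if_Tstep_UNIV) (auto simp: mem_Tstep_Rect)
next
  case (3 i j)
  let ?A = "A - add_lines R C {}"
  have fin: "finite ?A" using 3 by auto
  from "3.prems"(1) consider
      y where "Suc i \<le> card {x. (x, y) \<in> ?A}" "peels (Suc i) j (?A - UNIV \<times> {y})"
    | x where "Suc j \<le> card {y. (x, y) \<in> ?A}" "peels i (Suc j) (?A - {x} \<times> UNIV)"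
    unfolding peels.simps by blast
  then show ?case
  proof cases
    case 1
    have eq: "?A - UNIV \<times> {y} = A - add_lines (insert y R) C {}" by (auto simp: add_lines_def)
    \<comment> \<open>A positive threshold forces a residual point on the row, so the row is a new
      one and \<open>card R\<close> really grows by one.\<close>
    have "{x. (x, y) \<in> ?A} \<noteq> {}" using 1 by (metis card.empty not_less_eq_eq zero_le)
    then have y: "y \<notin> R" by (auto simp: add_lines_def)
    have "spans (Rect a b) (add_lines (insert y R) C A)"
      using 1 y 3 eq by (intro "3.hyps"(1)[of y]) auto
    moreover have "enat a \<le> rowcnt (x, y) (add_lines R C A)" for x unfolding rowcnt_def
    proof (rule le_ecard[of "(C \<union> {x. (x, y) \<in> ?A}) \<times> {y}"])
      have "card (C \<union> {x. (x, y) \<in> ?A}) = card C + card {x. (x, y) \<in> ?A}"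
        using 3 by (intro card_Un_disjoint finite_row fin) (auto simp: add_lines_def)
      then show "a \<le> card ((C \<union> {x. (x, y) \<in> ?A}) \<times> {y})"
        using 1 3 by (simp add: card_cartesian_product)
    qed (use 3 finite_row[OF fin] in \<open>auto simp: add_lines_def\<close>)
    then have "add_lines (insert y R) C A \<subseteq> Tstep (Rect a b) (add_lines R C A)"
      by (auto simp: mem_Tstep_Rect) (auto simp: add_lines_def)
    ultimately show ?thesis using spans_mono spans_TstepD by blast
  next
    case 2
    have eq: "?A - {x} \<times> UNIV = A - add_lines R (insert x C) {}" by (auto simp: add_lines_def)
    have "{y. (x, y) \<in> ?A} \<noteq> {}" using 2 by (metis card.empty not_less_eq_eq zero_le)
    then have x: "x \<notin> C" by (auto simp: add_lines_def)
    have "spans (Rect a b) (add_lines R (insert x C) A)"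
      using 2 x 3 eq by (intro "3.hyps"(2)[of x]) auto
    moreover have "enat b \<le> colcnt (x, y) (add_lines R C A)" for y unfolding colcnt_def
    proof (rule le_ecard[of "{x} \<times> (R \<union> {y. (x, y) \<in> ?A})"])
      have "card (R \<union> {y. (x, y) \<in> ?A}) = card R + card {y. (x, y) \<in> ?A}"
        using 3 by (intro card_Un_disjoint finite_column fin) (auto simp: add_lines_def)
      then show "b \<le> card ({x} \<times> (R \<union> {y. (x, y) \<in> ?A}))"
        using 2 3 by (simp add: card_cartesian_product)
    qed (use 3 finite_column[OF fin] in \<open>auto simp: add_lines_def\<close>)
    then have "add_lines R (insert x C) A \<subseteq> Tstep (Rect a b) (add_lines R C A)"
      by (auto simp: mem_Tstep_Rect) (auto simp: add_lines_def)
    ultimately show ?thesis using spans_mono spans_TstepD by blast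
  qed
qed

text \<open>In its row, a point off the filled lines sees only the full columns and the residual
  points, and symmetrically in its column. Both counts therefore stay below the thresholds.\<close>

lemma add_lines_closed:
  assumes "finite A" "finite R" "finite C"
    and rows: "\<And>y. card C + card {x. (x, y) \<in> A - add_lines R C {}} < a"
    and cols: "\<And>x. card R + card {y. (x, y) \<in> A - add_lines R C {}} < b"
  shows "Tstep (Rect a b) (add_lines R C A) \<subseteq> add_lines R C A"
proof (rule subsetI, rule ccontr)
  let ?A = "A - add_lines R C {}"
  have fin: "finite ?A" using assms(1) by simp
  fix z assume z: "z \<in> Tstep (Rect a b) (add_lines R C A)" "z \<notin> add_lines R C A"
  obtain x y where xy: "z = (x, y)" by (cases z)
  have nR: "x \<notin> C" "y \<notin> R" using z by (auto simp: add_lines_def xy)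
  have "{w \<in> add_lines R C A. snd w = y} = (C \<union> {x. (x, y) \<in> ?A}) \<times> {y}"
    using nR by (auto simp: add_lines_def)
  then have "rowcnt z (add_lines R C A) = enat (card (C \<union> {x. (x, y) \<in> ?A}))"
    using assms(2,3) finite_row[OF fin] by (simp add: rowcnt_def ecard_def card_cartesian_product xy finite_cartesian_product_iff)
  also have "card (C \<union> {x. (x, y) \<in> ?A}) \<le> card C + card {x. (x, y) \<in> ?A}" by (rule card_Un_le)
  also have "\<dots> < a" by (rule rows)
  finally have 1: "rowcnt z (add_lines R C A) < enat a" by simp
  have "{w \<in> add_lines R C A. fst w = x} = {x} \<times> (R \<union> {y. (x, y) \<in> ?A})"
    using nR by (auto simp: add_lines_def)
  then have "colcnt z (add_lines R C A) = enat (card (R \<union> {y. (x, y) \<in> ?A}))"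
    using assms(2,3) finite_column[OF fin] by (simp add: colcnt_def ecard_def card_cartesian_product xy finite_cartesian_product_iff)
  also have "card (R \<union> {y. (x, y) \<in> ?A}) \<le> card R + card {y. (x, y) \<in> ?A}" by (rule card_Un_le)
  also have "\<dots> < b" by (rule cols)
  finally have 2: "colcnt z (add_lines R C A) < enat b" by simp
  show False using z 1 2 by (auto simp: mem_Tstep_Rect)
qed

text \<open>If peeling fails, it fails after the removal of any heavy line, so an arbitrary one may
  be chosen and the argument repeated. A threshold 0 is never reached, as \<open>peels\<close> holds
  there; hence the process stops at a state without heavy lines, and that state is closed.\<close>

lemma not_peels_closed:
  assumes "\<not> peels i j (A - add_lines R C {})" "finite A" "finite R" "finite C"
    and "card C + i = a" "card R + j = b"
  shows "\<exists>D. add_lines R C A \<subseteq> D \<and> Tstep (Rect a b) D \<subseteq> D \<and> D \<noteq> UNIV"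
  using assms
proof (induction i j "A - add_lines R C {}" arbitrary: R C rule: peels.induct)
  case (3 i j)
  let ?A = "A - add_lines R C {}"
  consider y where "Suc i \<le> card {x. (x, y) \<in> ?A}" | x where "Suc j \<le> card {y. (x, y) \<in> ?A}"
    | "\<And>y. card {x. (x, y) \<in> ?A} < Suc i" "\<And>x. card {y. (x, y) \<in> ?A} < Suc j"
    by (metis not_le)
  then show ?case
  proof cases
    case 1
    have eq: "?A - UNIV \<times> {y} = A - add_lines (insert y R) C {}" by (auto simp: add_lines_def)
    have "{x. (x, y) \<in> ?A} \<noteq> {}" using 1 by (metis card.empty not_less_eq_eq zero_le)
    then have y: "y \<notin> R" by (auto simp: add_lines_def)
    have "\<not> peels (Suc i) j (?A - UNIV \<times> {y})" using 3 1 by auto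
    then have "\<exists>D. add_lines (insert y R) C A \<subseteq> D \<and> Tstep (Rect a b) D \<subseteq> D \<and> D \<noteq> UNIV"
      using y 3 eq by (intro "3.hyps"(1)[of y]) auto
    moreover have "add_lines R C A \<subseteq> add_lines (insert y R) C A" by (auto simp: add_lines_def)
    ultimately show ?thesis by blast
  next
    case 2
    have eq: "?A - {x} \<times> UNIV = A - add_lines R (insert x C) {}" by (auto simp: add_lines_def)
    have "{y. (x, y) \<in> ?A} \<noteq> {}" using 2 by (metis card.empty not_less_eq_eq zero_le)
    then have x: "x \<notin> C" by (auto simp: add_lines_def)
    have "\<not> peels i (Suc j) (?A - {x} \<times> UNIV)" using 3 2 by auto
    then have "\<exists>D. add_lines R (insert x C) A \<subseteq> D \<and> Tstep (Rect a b) D \<subseteq> D \<and> D \<noteq> UNIV"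
      using x 3 eq by (intro "3.hyps"(2)[of x]) auto
    moreover have "add_lines R C A \<subseteq> add_lines R (insert x C) A" by (auto simp: add_lines_def)
    ultimately show ?thesis by blast
  next
    case 3
    have "Tstep (Rect a b) (add_lines R C A) \<subseteq> add_lines R C A"
      using "3.prems" 3 by (intro add_lines_closed) auto
    moreover have "add_lines R C A \<noteq> UNIV"
    proof -
      \<comment> \<open>A column outside \<open>C\<close> that carries no point of \<open>A\<close>
        crosses a row outside \<open>R\<close> at an empty site.\<close>
      obtain x where x: "x \<notin> C \<union> fst ` A" using "3.prems" ex_new_if_finite[of "C \<union> fst ` A"] by auto
      obtain y where y: "y \<notin> R" using "3.prems" ex_new_if_finite[of R] by auto
      have "(x, y) \<notin> add_lines R C A" using x y by (force simp: add_lines_def)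
      then show ?thesis by blast
    qed
    ultimately show ?thesis by blast
  qed
qed auto

lemma spans_iff_peels:
  assumes "finite A" shows "spans (Rect a b) A \<longleftrightarrow> peels a b A"
proof
  have [simp]: "add_lines {} {} B = B" for B by (simp add: add_lines_def)
  show "spans (Rect a b) A" if "peels a b A"
    using peels_imp_spans[of a b A "{}" "{}" a b] that assms by simp
  show "peels a b A" if "spans (Rect a b) A"
  proof (rule ccontr)
    assume "\<not> peels a b A"
    then obtain D where "A \<subseteq> D" "Tstep (Rect a b) D \<subseteq> D" "D \<noteq> UNIV"
      using not_peels_closed[of a b A "{}" "{}" a b] assms by auto
    then show False using not_spans_if_closed that by blast
  qed
qed

section \<open>Recursive bounds on the spanning probability\<close>

lemma rprob_swap: "rprob p (X \<times> Y) P = rprob p (Y \<times> X) (\<lambda>S. P (prod.swap ` S))"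
proof -
  have "X \<times> Y = prod.swap ` (Y \<times> X)" by auto
  then show ?thesis by (simp add: rprob_image)
qed

lemma rprob_row:
  "rprob p (X \<times> {y}) (\<lambda>S. P {x. (x, y) \<in> S}) = rprob p X P"
proof -
  have "X \<times> {y} = (\<lambda>x. (x, y)) ` X" by auto
  moreover have "inj_on (\<lambda>x. (x, y)) X" by (rule inj_onI) simp
  ultimately have "rprob p (X \<times> {y}) (\<lambda>S. P {x. (x, y) \<in> S}) =
      rprob p X (\<lambda>S. P {x. (x, y) \<in> (\<lambda>x. (x, y)) ` S})"
    by (simp only: rprob_image)
  also have "(\<lambda>S. P {x. (x, y) \<in> (\<lambda>x. (x, y)) ` S}) = P" by (auto simp: image_iff)
  finally show ?thesis .
qed

lemma rprob_row_and_rest: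
  assumes "finite X" "finite Y" "y \<in> Y"
  shows "rprob p (X \<times> Y) (\<lambda>S. P {x. (x, y) \<in> S} \<and> Q (S - UNIV \<times> {y})) =
    rprob p X P * rprob p (X \<times> (Y - {y})) Q"
proof -
  have "rprob p (X \<times> Y) (\<lambda>S. P {x. (x, y) \<in> S} \<and> Q (S - UNIV \<times> {y})) =
    rprob p (X \<times> Y) (\<lambda>S. (\<lambda>T. P {x. (x, y) \<in> T}) (S \<inter> X \<times> {y}) \<and> Q (S \<inter> X \<times> (Y - {y})))"
  proof (rule rprob_cong)
    fix S assume "S \<subseteq> X \<times> Y"
    then have "{x. (x, y) \<in> S} = {x. (x, y) \<in> S \<inter> X \<times> {y}}"
      and "S - UNIV \<times> {y} = S \<inter> X \<times> (Y - {y})" by auto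
    then show "(P {x. (x, y) \<in> S} \<and> Q (S - UNIV \<times> {y})) =
        ((\<lambda>T. P {x. (x, y) \<in> T}) (S \<inter> X \<times> {y}) \<and> Q (S \<inter> X \<times> (Y - {y})))" by simp
  qed
  also have "\<dots> = rprob p (X \<times> {y}) (\<lambda>T. P {x. (x, y) \<in> T}) * rprob p (X \<times> (Y - {y})) Q"
    using assms by (intro rprob_indep_subsets) auto
  finally show ?thesis by (simp add: rprob_row)
qed

text \<open>The factor 1 is monotonicity alone. The other factor is a union bound over the rows: the
  row and the rest are independent, and the event on the rest is enlarged from
  \<open>Y - {y}\<close> back to \<open>Y\<close>.\<close>

lemma rprob_remove_row_le:
  assumes "finite X" "finite Y" "0 \<le> p" "p \<le> 1" "1 \<le> k"
    and mono: "\<And>A B. P A \<Longrightarrow> A \<subseteq> B \<Longrightarrow> finite B \<Longrightarrow> P B"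
  shows "rprob p (X \<times> Y) (\<lambda>S. \<exists>y. k \<le> card {x. (x, y) \<in> S} \<and> P (S - UNIV \<times> {y}))
    \<le> min 1 (real (card Y) * (real (card X) * p) ^ k) * rprob p (X \<times> Y) P"
    (is "?L \<le> _")
proof -
  have fin: "finite (X \<times> Y)" using assms by simp
  have finS: "finite S" if "S \<subseteq> X \<times> Y" for S using that fin finite_subset by blast
  have 1: "?L \<le> rprob p (X \<times> Y) P"
    by (rule rprob_mono[OF fin assms(3,4)]) (use mono finS in blast)
  have "?L \<le> rprob p (X \<times> Y) (\<lambda>S. \<exists>y\<in>Y. k \<le> card {x. (x, y) \<in> S} \<and> P (S - UNIV \<times> {y}))"
  proof (rule rprob_mono[OF fin assms(3,4)])
    fix S assume S: "S \<subseteq> X \<times> Y" "\<exists>y. k \<le> card {x. (x, y) \<in> S} \<and> P (S - UNIV \<times> {y})"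
    then obtain y where y: "k \<le> card {x. (x, y) \<in> S}" "P (S - UNIV \<times> {y})" by blast
    \<comment> \<open>As k is at least 1, a heavy row lies in \<open>Y\<close>; this makes the union
      finite.\<close>
    have "{x. (x, y) \<in> S} \<noteq> {}" using y(1) assms(5) by (metis card.empty not_one_le_zero order_trans)
    then show "\<exists>y\<in>Y. k \<le> card {x. (x, y) \<in> S} \<and> P (S - UNIV \<times> {y})" using S(1) y by blast
  qed
  also have "\<dots> \<le> (\<Sum>y\<in>Y. rprob p (X \<times> Y) (\<lambda>S. k \<le> card {x. (x, y) \<in> S} \<and> P (S - UNIV \<times> {y})))"
    by (rule rprob_Bex_le[OF fin assms(3,4,2)])
  also have "\<dots> \<le> (\<Sum>y\<in>Y. (real (card X) * p) ^ k * rprob p (X \<times> Y) P)"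
  proof (rule sum_mono)
    fix y assume y: "y \<in> Y"
    have "rprob p (X \<times> (Y - {y})) P = rprob p (X \<times> Y) (\<lambda>S. P (S \<inter> X \<times> (Y - {y})))"
      by (rule rprob_marginal[symmetric]) (use fin in auto)
    also have "\<dots> \<le> rprob p (X \<times> Y) P"
      by (rule rprob_mono[OF fin assms(3,4)]) (use mono finS in blast)
    finally have "rprob p (X \<times> (Y - {y})) P \<le> rprob p (X \<times> Y) P" .
    then show "rprob p (X \<times> Y) (\<lambda>S. k \<le> card {x. (x, y) \<in> S} \<and> P (S - UNIV \<times> {y}))
        \<le> (real (card X) * p) ^ k * rprob p (X \<times> Y) P"
      unfolding rprob_row_and_rest[OF assms(1,2) y, where P = "\<lambda>T. k \<le> card T"]
      using assms by (intro mult_mono rprob_card_ge_le rprob_nonneg) auto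
  qed
  finally have 2: "?L \<le> (real (card Y) * (real (card X) * p) ^ k) * rprob p (X \<times> Y) P" by simp
  show ?thesis using 1 2 by (simp add: min_def)
qed

lemma rprob_remove_column_le:
  assumes "finite X" "finite Y" "0 \<le> p" "p \<le> 1" "1 \<le> k"
    and mono: "\<And>A B. P A \<Longrightarrow> A \<subseteq> B \<Longrightarrow> finite B \<Longrightarrow> P B"
  shows "rprob p (X \<times> Y) (\<lambda>S. \<exists>x. k \<le> card {y. (x, y) \<in> S} \<and> P (S - {x} \<times> UNIV))
    \<le> min 1 (real (card X) * (real (card Y) * p) ^ k) * rprob p (X \<times> Y) P"
proof -
  have diff: "prod.swap ` S - {x} \<times> UNIV = prod.swap ` (S - UNIV \<times> {x})"
    for S :: "('b \<times> 'a) set" and x by auto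
  have "rprob p (Y \<times> X) (\<lambda>S. \<exists>x. k \<le> card {y. (y, x) \<in> S} \<and> P (prod.swap ` (S - UNIV \<times> {x})))
    \<le> min 1 (real (card X) * (real (card Y) * p) ^ k) * rprob p (Y \<times> X) (\<lambda>S. P (prod.swap ` S))"
    using assms(1-5) by (intro rprob_remove_row_le) (auto intro: mono image_mono)
  then show ?thesis
    by (subst (1 2) rprob_swap) (simp add: diff)
qed

section \<open>Lower bounds for the existence of a heavy line\<close>

lemma min_le_one_minus_power:
  fixes q :: real
  assumes "0 \<le> q" "q \<le> 1"
  shows "min 1 (real m * q) / 2 \<le> 1 - (1 - q) ^ m"
proof -
  \<comment> \<open>Multiplying by \<open>(1 + q) ^ m\<close> turns Bernoulli's lower bound for that
    power into the upper bound \<open>1 / (1 + m q)\<close> for \<open>(1 - q) ^ m\<close>.\<close>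
  have "(1 - q) ^ m * (1 + real m * q) \<le> (1 - q) ^ m * (1 + q) ^ m"
    using assms Bernoulli_inequality[of q m] by (intro mult_left_mono) auto
  also have "\<dots> = (1 - q\<^sup>2) ^ m"
    by (simp add: power_mult_distrib[symmetric] algebra_simps power2_eq_square)
  also have "\<dots> \<le> 1" using assms by (simp add: power_le_one)
  finally have "(1 - q) ^ m \<le> 1 / (1 + real m * q)"
    using assms by (simp add: field_simps add_pos_nonneg)
  \<comment> \<open>With t = m q the right-hand side is t / (1 + t), which is at least t / 2 for t
    \<le> 1 and at least 1/2 beyond.\<close>
  moreover have "min 1 (real m * q) / 2 \<le> 1 - 1 / (1 + real m * q)"
  proof -
    define t where "t = real m * q"
    have t: "0 \<le> t" using assms by (simp add: t_def)
    show ?thesis unfolding t_def[symmetric] using t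
      by (cases "t \<le> 1") (auto simp: field_simps min_def mult_left_le)
  qed
  ultimately show ?thesis by simp
qed

lemma rprob_no_row:
  assumes "finite X" "finite Y"
  shows "rprob p (X \<times> Y) (\<lambda>S. \<forall>y\<in>Y. \<not> P {x. (x, y) \<in> S}) = (1 - rprob p X P) ^ card Y"
  using assms(2)
proof induction
  case empty
  show ?case by (simp add: rprob_True)
next
  case (insert y Y)
  have "rprob p (X \<times> insert y Y) (\<lambda>S. \<forall>z\<in>insert y Y. \<not> P {x. (x, z) \<in> S}) =
      rprob p (X \<times> insert y Y) (\<lambda>S. \<not> P {x. (x, y) \<in> S} \<and>
        (\<lambda>T. \<forall>z\<in>Y. \<not> P {x. (x, z) \<in> T}) (S - UNIV \<times> {y}))"
  proof (rule rprob_cong)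
    fix S assume "S \<subseteq> X \<times> insert y Y"
    have "{x. (x, z) \<in> S - UNIV \<times> {y}} = {x. (x, z) \<in> S}" if "z \<in> Y" for z
      using that insert by auto
    then show "(\<forall>z\<in>insert y Y. \<not> P {x. (x, z) \<in> S}) =
        (\<not> P {x. (x, y) \<in> S} \<and> (\<lambda>T. \<forall>z\<in>Y. \<not> P {x. (x, z) \<in> T}) (S - UNIV \<times> {y}))" by auto
  qed
  also have "\<dots> = rprob p X (\<lambda>T. \<not> P T) *
      rprob p (X \<times> (insert y Y - {y})) (\<lambda>T. \<forall>z\<in>Y. \<not> P {x. (x, z) \<in> T})"
    using insert assms by (intro rprob_row_and_rest) auto
  also have "insert y Y - {y} = Y" using insert by auto
  finally show ?case using insert assms by (simp add: rprob_Not)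
qed

lemma rprob_some_row_ge:
  assumes "finite X" "finite Y" "0 \<le> p" "p \<le> 1" "k \<le> card X" "real (card X) * p \<le> 1 / 2"
  shows "min 1 (real (card Y) * ((real (card X) * p / real k) ^ k / 2)) / 2
    \<le> rprob p (X \<times> Y) (\<lambda>S. \<exists>y\<in>Y. k \<le> card {x. (x, y) \<in> S})"
proof -
  let ?q = "rprob p X (\<lambda>T. k \<le> card T)"
  have "min 1 (real (card Y) * ((real (card X) * p / real k) ^ k / 2)) / 2
      \<le> min 1 (real (card Y) * ?q) / 2"
    using rprob_card_ge_ge[OF assms(1,3-6)]
    by (intro divide_right_mono min.mono mult_left_mono) auto
  also have "\<dots> \<le> 1 - (1 - ?q) ^ card Y"
    using assms by (intro min_le_one_minus_power rprob_nonneg rprob_le_1) auto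
  also have "\<dots> = 1 - rprob p (X \<times> Y) (\<lambda>S. \<not> (\<exists>y\<in>Y. k \<le> card {x. (x, y) \<in> S}))"
    using rprob_no_row[OF assms(1,2), of p "\<lambda>T. k \<le> card T"] by simp
  also have "\<dots> = rprob p (X \<times> Y) (\<lambda>S. \<exists>y\<in>Y. k \<le> card {x. (x, y) \<in> S})"
    using assms by (subst rprob_Not) auto
  finally show ?thesis .
qed

lemma rprob_some_column_ge:
  assumes "finite X" "finite Y" "0 \<le> p" "p \<le> 1" "k \<le> card Y" "real (card Y) * p \<le> 1 / 2"
  shows "min 1 (real (card X) * ((real (card Y) * p / real k) ^ k / 2)) / 2
    \<le> rprob p (X \<times> Y) (\<lambda>S. \<exists>x\<in>X. k \<le> card {y. (x, y) \<in> S})"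
  using rprob_some_row_ge[OF assms(2,1,3-6)]
  by (subst rprob_swap) simp

text \<open>Solutions of the recursion obtained by removing one line at a time; \<open>r i\<close> bounds the
  probability that some row has \<open>i\<close> points, \<open>c j\<close> that some column has \<open>j\<close> points.\<close>

fun upper_rec :: "(nat \<Rightarrow> real) \<Rightarrow> (nat \<Rightarrow> real) \<Rightarrow> nat \<Rightarrow> nat \<Rightarrow> real" where
  "upper_rec r c 0 j = 1"
| "upper_rec r c (Suc i) 0 = 1"
| "upper_rec r c (Suc i) (Suc j) =
    r (Suc i) * upper_rec r c (Suc i) j + c (Suc j) * upper_rec r c i (Suc j)"

fun lower_rec :: "(nat \<Rightarrow> real) \<Rightarrow> (nat \<Rightarrow> real) \<Rightarrow> nat \<Rightarrow> nat \<Rightarrow> real" where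
  "lower_rec r c 0 j = 1"
| "lower_rec r c (Suc i) 0 = 1"
| "lower_rec r c (Suc i) (Suc j) =
    max (r (Suc i) * lower_rec r c (Suc i) j) (c (Suc j) * lower_rec r c i (Suc j))"

lemma rprob_peels_le:
  assumes fin: "finite X" "finite Y" and p: "0 \<le> p" "p \<le> 1"
  defines "r \<equiv> \<lambda>i. min 1 (real (card Y) * (real (card X) * p) ^ i)"
      and "c \<equiv> \<lambda>j. min 1 (real (card X) * (real (card Y) * p) ^ j)"
  shows "rprob p (X \<times> Y) (peels i j) \<le> upper_rec r c i j"
proof (induction i arbitrary: j)
  case 0
  show ?case using rprob_le_1[of "X \<times> Y"] fin p by simp
next
  case (Suc i)
  \<comment> \<open>Removing a column lowers i and uses this outer hypothesis for every j; removing
    a row lowers j and uses the inner induction.\<close>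
  note column = Suc.IH
  show ?case
  proof (induction j)
    case 0
    show ?case using rprob_le_1[of "X \<times> Y"] fin p by simp
  next
    case (Suc j)
    let ?R = "\<lambda>S. \<exists>y. Suc i \<le> card {x. (x, y) \<in> S} \<and> peels (Suc i) j (S - UNIV \<times> {y})"
    let ?C = "\<lambda>S. \<exists>x. Suc j \<le> card {y. (x, y) \<in> S} \<and> peels i (Suc j) (S - {x} \<times> UNIV)"
    have "rprob p (X \<times> Y) (peels (Suc i) (Suc j)) = rprob p (X \<times> Y) (\<lambda>S. ?R S \<or> ?C S)"
      by (rule rprob_cong) (rule peels.simps)
    also have "\<dots> \<le> rprob p (X \<times> Y) ?R + rprob p (X \<times> Y) ?C"
      using fin p by (intro rprob_disj_le) auto
    also have "\<dots> \<le> r (Suc i) * rprob p (X \<times> Y) (peels (Suc i) j) +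
        c (Suc j) * rprob p (X \<times> Y) (peels i (Suc j))"
      unfolding r_def c_def using fin p
      by (intro add_mono rprob_remove_row_le rprob_remove_column_le) (auto intro: peels_mono)
    also have "\<dots> \<le> r (Suc i) * upper_rec r c (Suc i) j + c (Suc j) * upper_rec r c i (Suc j)"
      using p by (intro add_mono mult_left_mono Suc column) (auto simp: r_def c_def)
    finally show ?case by (simp only: upper_rec.simps)
  qed
qed

lemma lower_rec_nonneg:
  assumes "\<And>i. 0 \<le> r i" "\<And>j. 0 \<le> c j" shows "0 \<le> lower_rec r c i j"
  using assms by (induction r c i j rule: lower_rec.induct) (auto simp: le_max_iff_disj)

lemma obtain_split:
  assumes "finite X" "n + k \<le> card X"
  obtains X1 X2 where "X1 \<subseteq> X" "X2 \<subseteq> X" "X1 \<inter> X2 = {}" "finite X1" "finite X2"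
    "card X1 = n" "k \<le> card X2"
proof -
  have "n \<le> card X" using assms by simp
  then obtain X1 where X1: "X1 \<subseteq> X" "card X1 = n" "finite X1"
    by (rule obtain_subset_with_card_n)
  then have "k \<le> card (X - X1)" using assms by (simp add: card_Diff_subset)
  then show ?thesis by (intro that[of X1 "X - X1"]) (use X1 assms(1) in auto)
qed

text \<open>The peeled line is sought in a block \<open>X1 \<times> Y1\<close> and the rest of the peeling in a block
  \<open>X2 \<times> Y2\<close> that has neither rows nor columns in common with it; this makes the two events
  independent, at the price of a constant factor in the side lengths.\<close>

lemma rprob_peels_ge:
  assumes p: "0 \<le> p" "p \<le> 1" and n: "a \<le> n" "b \<le> m" "real n * p \<le> 1 / 2" "real m * p \<le> 1 / 2"
  defines "r \<equiv> \<lambda>i. min 1 (real m * ((real n * p / real i) ^ i / 2)) / 2"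
      and "c \<equiv> \<lambda>j. min 1 (real n * ((real m * p / real j) ^ j / 2)) / 2"
  assumes "finite X" "finite Y" "i \<le> a" "j \<le> b" "(i + j) * n \<le> card X" "(i + j) * m \<le> card Y"
  shows "lower_rec r c i j \<le> rprob p (X \<times> Y) (peels i j)"
proof -
  have nonneg: "0 \<le> lower_rec r c i j" for i j
    using p by (intro lower_rec_nonneg) (auto simp: r_def c_def)
  show ?thesis using assms(9-)
  proof (induction i arbitrary: j X Y)
    case 0
    then show ?case by (simp add: rprob_True)
  next
    case (Suc i)
    note column = Suc.IH
    show ?case using Suc.prems
    proof (induction j arbitrary: X Y)
      case 0
      then show ?case by (simp add: rprob_True)
    next
      case (Suc j)
      note prems = Suc.prems
      have fin: "finite (X \<times> Y)" using prems by simp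
      \<comment> \<open>From thresholds i and j at most i + j lines are removed, and each removal
        uses up n columns and m rows of its own.\<close>
      have "n + (Suc i + j) * n \<le> card X" using prems by simp
      then obtain X1 X2 where X: "X1 \<subseteq> X" "X2 \<subseteq> X" "X1 \<inter> X2 = {}" "finite X1" "finite X2"
          "card X1 = n" "(Suc i + j) * n \<le> card X2"
        by (rule obtain_split[OF prems(1)])
      have "m + (Suc i + j) * m \<le> card Y" using prems by simp
      then obtain Y1 Y2 where Y: "Y1 \<subseteq> Y" "Y2 \<subseteq> Y" "Y1 \<inter> Y2 = {}" "finite Y1" "finite Y2"
          "card Y1 = m" "(Suc i + j) * m \<le> card Y2"
        by (rule obtain_split[OF prems(2)])
      have finS: "finite S" if "S \<subseteq> X \<times> Y" for S using that fin finite_subset by blast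
      have "r (Suc i) * lower_rec r c (Suc i) j \<le>
          rprob p (X1 \<times> Y1) (\<lambda>S. \<exists>y\<in>Y1. Suc i \<le> card {x. (x, y) \<in> S}) *
          rprob p (X2 \<times> Y2) (peels (Suc i) j)"
      proof (rule mult_mono)
        show "r (Suc i) \<le> rprob p (X1 \<times> Y1) (\<lambda>S. \<exists>y\<in>Y1. Suc i \<le> card {x. (x, y) \<in> S})"
          using rprob_some_row_ge[of X1 Y1 p "Suc i"] p n X Y prems by (simp add: r_def)
        show "lower_rec r c (Suc i) j \<le> rprob p (X2 \<times> Y2) (peels (Suc i) j)"
          by (rule Suc.IH) (use X Y prems in auto)
      qed (intro nonneg rprob_nonneg p)+
      also have "\<dots> = rprob p (X \<times> Y) (\<lambda>S. (\<lambda>S. \<exists>y\<in>Y1. Suc i \<le> card {x. (x, y) \<in> S}) (S \<inter> X1 \<times> Y1) \<and>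
          peels (Suc i) j (S \<inter> X2 \<times> Y2))"
        using X Y by (intro rprob_indep_subsets[symmetric] fin) auto
      also have "\<dots> \<le> rprob p (X \<times> Y) (peels (Suc i) (Suc j))"
      proof (rule rprob_mono[OF fin p])
        fix S assume S: "S \<subseteq> X \<times> Y" and "(\<lambda>S. \<exists>y\<in>Y1. Suc i \<le> card {x. (x, y) \<in> S}) (S \<inter> X1 \<times> Y1) \<and>
          peels (Suc i) j (S \<inter> X2 \<times> Y2)"
        then obtain y where y: "y \<in> Y1" "Suc i \<le> card {x. (x, y) \<in> S \<inter> X1 \<times> Y1}"
          "peels (Suc i) j (S \<inter> X2 \<times> Y2)" by blast
        have "card {x. (x, y) \<in> S \<inter> X1 \<times> Y1} \<le> card {x. (x, y) \<in> S}"
          by (intro card_mono finite_row finS S) auto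
        \<comment> \<open>The row y lies in \<open>Y1\<close>, so its removal leaves the block
          \<open>X2 \<times> Y2\<close> untouched.\<close>
        moreover have "peels (Suc i) j (S - UNIV \<times> {y})"
          by (rule peels_mono[OF y(3)]) (use Y y(1) finS[OF S] in auto)
        ultimately show "peels (Suc i) (Suc j) S" using y(2) unfolding peels.simps by (meson order_trans)
      qed
      finally have 1: "r (Suc i) * lower_rec r c (Suc i) j \<le> rprob p (X \<times> Y) (peels (Suc i) (Suc j))" .
      have "c (Suc j) * lower_rec r c i (Suc j) \<le>
          rprob p (X1 \<times> Y1) (\<lambda>S. \<exists>x\<in>X1. Suc j \<le> card {y. (x, y) \<in> S}) *
          rprob p (X2 \<times> Y2) (peels i (Suc j))"
      proof (rule mult_mono)
        show "c (Suc j) \<le> rprob p (X1 \<times> Y1) (\<lambda>S. \<exists>x\<in>X1. Suc j \<le> card {y. (x, y) \<in> S})"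
          using rprob_some_column_ge[of X1 Y1 p "Suc j"] p n X Y prems by (simp add: c_def)
        show "lower_rec r c i (Suc j) \<le> rprob p (X2 \<times> Y2) (peels i (Suc j))"
          by (rule column) (use X Y prems in auto)
      qed (intro nonneg rprob_nonneg p)+
      also have "\<dots> = rprob p (X \<times> Y) (\<lambda>S. (\<lambda>S. \<exists>x\<in>X1. Suc j \<le> card {y. (x, y) \<in> S}) (S \<inter> X1 \<times> Y1) \<and>
          peels i (Suc j) (S \<inter> X2 \<times> Y2))"
        using X Y by (intro rprob_indep_subsets[symmetric] fin) auto
      also have "\<dots> \<le> rprob p (X \<times> Y) (peels (Suc i) (Suc j))"
      proof (rule rprob_mono[OF fin p])
        fix S assume S: "S \<subseteq> X \<times> Y" and "(\<lambda>S. \<exists>x\<in>X1. Suc j \<le> card {y. (x, y) \<in> S}) (S \<inter> X1 \<times> Y1) \<and>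
          peels i (Suc j) (S \<inter> X2 \<times> Y2)"
        then obtain x where x: "x \<in> X1" "Suc j \<le> card {y. (x, y) \<in> S \<inter> X1 \<times> Y1}"
          "peels i (Suc j) (S \<inter> X2 \<times> Y2)" by blast
        have "card {y. (x, y) \<in> S \<inter> X1 \<times> Y1} \<le> card {y. (x, y) \<in> S}"
          by (intro card_mono finite_column finS S) auto
        moreover have "peels i (Suc j) (S - {x} \<times> UNIV)"
          by (rule peels_mono[OF x(3)]) (use X x(1) finS[OF S] in auto)
        ultimately show "peels (Suc i) (Suc j) S" using x(2) unfolding peels.simps by (meson order_trans)
      qed
      finally have 2: "c (Suc j) * lower_rec r c i (Suc j) \<le> rprob p (X \<times> Y) (peels (Suc i) (Suc j))" .
      show ?case using 1 2 by (simp only: lower_rec.simps max.bounded_iff)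
    qed
  qed
qed

section \<open>Logarithmic rates\<close>

text \<open>This says f(p) = p^(v + o(1)). Positivity is demanded separately because
  \<open>ln\<close> has no meaning at the value 0. As \<open>ln p\<close> is negative, larger
  functions have smaller exponents.\<close>

definition log_rate :: "(real \<Rightarrow> real) \<Rightarrow> real \<Rightarrow> bool" where
  "log_rate f v \<longleftrightarrow> (\<forall>\<^sub>F p in at_right 0. 0 < f p) \<and>
     ((\<lambda>p. ln (f p) / ln p) \<longlongrightarrow> v) (at_right 0)"

lemma eventually_at_right_0_1: "\<forall>\<^sub>F p in at_right (0::real). 0 < p \<and> p < 1"
  by (rule eventually_at_rightI[of 0 1]) auto

lemma log_rateI:
  assumes "\<forall>\<^sub>F p in at_right 0. g p = ln (f p) / ln p" "(g \<longlongrightarrow> v) (at_right 0)"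
    "\<forall>\<^sub>F p in at_right 0. 0 < f p"
  shows "log_rate f v"
  unfolding log_rate_def using assms Lim_transform_eventually[OF assms(2,1)] by simp

lemma log_rate_const: "0 < k \<Longrightarrow> log_rate (\<lambda>p. k) 0"
  unfolding log_rate_def
  by (auto intro!: tendsto_divide_0[OF tendsto_const] filterlim_mono[OF ln_at_0 at_bot_le_at_infinity])

lemma log_rate_id: "log_rate (\<lambda>p. p) 1"
  unfolding log_rate_def
proof
  show "\<forall>\<^sub>F p in at_right 0. 0 < (p::real)"
    using eventually_at_right_0_1 by eventually_elim simp
  have "\<forall>\<^sub>F p in at_right (0::real). 1 = ln p / ln p"
    using eventually_at_right_0_1 by eventually_elim (auto simp: ln_eq_zero_iff)
  then show "((\<lambda>p. ln p / ln p) \<longlongrightarrow> (1::real)) (at_right 0)"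
    by (rule Lim_transform_eventually[OF tendsto_const])
qed

lemma log_rate_mult:
  assumes "log_rate f u" "log_rate g v" shows "log_rate (\<lambda>p. f p * g p) (u + v)"
proof -
  have ev: "\<forall>\<^sub>F p in at_right 0. 0 < f p \<and> 0 < g p"
    using assms by (auto simp: log_rate_def eventually_conj_iff)
  have "\<forall>\<^sub>F p in at_right 0. ln (f p) / ln p + ln (g p) / ln p = ln (f p * g p) / ln p"
    using ev by eventually_elim (simp add: ln_mult add_divide_distrib)
  moreover have "((\<lambda>p. ln (f p) / ln p + ln (g p) / ln p) \<longlongrightarrow> u + v) (at_right 0)"
    using assms by (auto simp: log_rate_def intro: tendsto_add)
  moreover have "\<forall>\<^sub>F p in at_right 0. 0 < f p * g p" using ev by eventually_elim simp
  ultimately show ?thesis by (rule log_rateI)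
qed

lemma log_rate_power: "log_rate f u \<Longrightarrow> log_rate (\<lambda>p. f p ^ k) (real k * u)"
proof (induction k)
  case (Suc k)
  then show ?case using log_rate_mult[of f u "\<lambda>p. f p ^ k" "real k * u"] by (simp add: algebra_simps)
qed (simp add: log_rate_const)

lemma log_rate_sandwich:
  assumes "log_rate f u" "log_rate h u" "\<forall>\<^sub>F p in at_right 0. f p \<le> g p \<and> g p \<le> h p"
  shows "log_rate g u"
proof -
  have ev: "\<forall>\<^sub>F p in at_right 0. 0 < p \<and> p < 1 \<and> 0 < f p \<and> f p \<le> g p \<and> g p \<le> h p"
    using assms eventually_at_right_0_1 by (auto simp: log_rate_def eventually_conj_iff)
  have "((\<lambda>p. ln (g p) / ln p) \<longlongrightarrow> u) (at_right 0)"
  proof (rule tendsto_sandwich)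
    show "\<forall>\<^sub>F p in at_right 0. ln (h p) / ln p \<le> ln (g p) / ln p"
      using ev by eventually_elim (auto intro!: divide_right_mono_neg)
    show "\<forall>\<^sub>F p in at_right 0. ln (g p) / ln p \<le> ln (f p) / ln p"
      using ev by eventually_elim (auto intro!: divide_right_mono_neg)
  qed (use assms in \<open>auto simp: log_rate_def\<close>)
  moreover have "\<forall>\<^sub>F p in at_right 0. 0 < g p" using ev by eventually_elim auto
  ultimately show ?thesis by (simp add: log_rate_def)
qed

lemma log_rate_max:
  assumes "log_rate f u" "log_rate g v" shows "log_rate (\<lambda>p. max (f p) (g p)) (min u v)"
proof -
  have ev: "\<forall>\<^sub>F p in at_right 0. 0 < p \<and> p < 1 \<and> 0 < f p \<and> 0 < g p"
    using assms eventually_at_right_0_1 by (auto simp: log_rate_def eventually_conj_iff)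
  have "\<forall>\<^sub>F p in at_right 0. min (ln (f p) / ln p) (ln (g p) / ln p) = ln (max (f p) (g p)) / ln p"
    using ev
  proof eventually_elim
    case (elim p)
    then have "(ln (g p) / ln p \<le> ln (f p) / ln p) \<longleftrightarrow> f p \<le> g p"
      by (simp add: divide_le_cancel not_less)
    then show ?case by (auto simp: min_def max_def)
  qed
  moreover have "((\<lambda>p. min (ln (f p) / ln p) (ln (g p) / ln p)) \<longlongrightarrow> min u v) (at_right 0)"
    using assms by (auto simp: log_rate_def intro: tendsto_min)
  moreover have "\<forall>\<^sub>F p in at_right 0. 0 < max (f p) (g p)" using ev by eventually_elim auto
  ultimately show ?thesis by (rule log_rateI)
qed

text \<open>A sum lies between the maximum and twice the maximum. Hence the sum in
  \<open>upper_rec\<close> and the maximum in \<open>lower_rec\<close> lead to the same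
  exponent.\<close>

lemma log_rate_add:
  assumes "log_rate f u" "log_rate g v" shows "log_rate (\<lambda>p. f p + g p) (min u v)"
proof (rule log_rate_sandwich)
  show "log_rate (\<lambda>p. max (f p) (g p)) (min u v)" by (rule log_rate_max[OF assms])
  show "log_rate (\<lambda>p. 2 * max (f p) (g p)) (min u v)"
    using log_rate_mult[OF log_rate_const[of 2] log_rate_max[OF assms]] by simp
  have "\<forall>\<^sub>F p in at_right 0. 0 < f p \<and> 0 < g p"
    using assms by (auto simp: log_rate_def eventually_conj_iff)
  then show "\<forall>\<^sub>F p in at_right 0. max (f p) (g p) \<le> f p + g p \<and> f p + g p \<le> 2 * max (f p) (g p)"
    by eventually_elim auto
qed

lemma log_rate_min_1:
  assumes "log_rate f u" shows "log_rate (\<lambda>p. min 1 (f p)) (max 0 u)"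
proof -
  have ev: "\<forall>\<^sub>F p in at_right 0. 0 < p \<and> p < 1 \<and> 0 < f p"
    using assms eventually_at_right_0_1 by (auto simp: log_rate_def eventually_conj_iff)
  have "\<forall>\<^sub>F p in at_right 0. max 0 (ln (f p) / ln p) = ln (min 1 (f p)) / ln p"
    using ev
  proof eventually_elim
    case (elim p)
    then have "(0 \<le> ln (f p) / ln p) \<longleftrightarrow> f p \<le> 1"
      by (auto simp: zero_le_divide_iff)
    then show ?case by (auto simp: min_def max_def)
  qed
  moreover have "((\<lambda>p. max 0 (ln (f p) / ln p)) \<longlongrightarrow> max 0 u) (at_right 0)"
    using assms by (auto simp: log_rate_def intro: tendsto_max)
  moreover have "\<forall>\<^sub>F p in at_right 0. 0 < min 1 (f p)" using ev by eventually_elim auto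
  ultimately show ?thesis by (rule log_rateI)
qed

text \<open>A function with positive exponent tends to 0. The constant is absorbed into the
  function, so that the bound to reach is 1, where the logarithm changes sign.\<close>

lemma log_rate_pos_imp_less:
  assumes "log_rate f u" "0 < u" "0 < k"
  shows "\<forall>\<^sub>F p in at_right 0. f p < k"
proof -
  have r: "log_rate (\<lambda>p. 1 / k * f p) u" using log_rate_mult[OF log_rate_const[of "1 / k"] assms(1)] assms by simp
  then have "\<forall>\<^sub>F p in at_right 0. 0 < ln (1 / k * f p) / ln p"
    using assms(2) by (auto simp: log_rate_def intro: order_tendstoD)
  moreover have "\<forall>\<^sub>F p in at_right 0. 0 < 1 / k * f p" using r by (simp add: log_rate_def)
  ultimately show ?thesis using eventually_at_right_0_1
  proof eventually_elim
    case (elim p)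
    then have "ln (1 / k * f p) < 0" by (simp add: zero_less_divide_iff)
    then have "1 / k * f p < 1" using elim by (simp add: ln_less_zero_iff)
    then show ?case using assms by (simp add: field_simps)
  qed
qed

text \<open>The common (min, +) shadow of \<open>upper_rec\<close> and \<open>lower_rec\<close> on
  exponents: products become sums, while sums and maxima become minima.\<close>

fun peel_cost :: "(nat \<Rightarrow> real) \<Rightarrow> (nat \<Rightarrow> real) \<Rightarrow> nat \<Rightarrow> nat \<Rightarrow> real" where
  "peel_cost r c 0 j = 0"
| "peel_cost r c (Suc i) 0 = 0"
| "peel_cost r c (Suc i) (Suc j) =
    min (r (Suc i) + peel_cost r c (Suc i) j) (c (Suc j) + peel_cost r c i (Suc j))"

lemma log_rate_upper_rec:
  assumes "\<And>i. log_rate (\<lambda>p. R p (Suc i)) (r (Suc i))" "\<And>j. log_rate (\<lambda>p. C p (Suc j)) (c (Suc j))"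
  shows "log_rate (\<lambda>p. upper_rec (R p) (C p) i j) (peel_cost r c i j)"
  using assms
proof (induction r c i j rule: peel_cost.induct)
  case (3 r c i j)
  then show ?case unfolding upper_rec.simps peel_cost.simps
    by (intro log_rate_add log_rate_mult) blast+
qed (simp_all add: log_rate_const)

lemma log_rate_lower_rec:
  assumes "\<And>i. log_rate (\<lambda>p. R p (Suc i)) (r (Suc i))" "\<And>j. log_rate (\<lambda>p. C p (Suc j)) (c (Suc j))"
  shows "log_rate (\<lambda>p. lower_rec (R p) (C p) i j) (peel_cost r c i j)"
  using assms
proof (induction r c i j rule: peel_cost.induct)
  case (3 r c i j)
  then show ?case unfolding lower_rec.simps peel_cost.simps
    by (intro log_rate_max log_rate_mult) blast+
qed (simp_all add: log_rate_const)

lemma log_rate_div: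
  fixes N :: "real \<Rightarrow> nat"
  assumes "log_rate (\<lambda>p. real (N p)) u" "filterlim N at_top (at_right 0)" "0 < k"
  shows "log_rate (\<lambda>p. real (N p div k)) u"
proof (rule log_rate_sandwich)
  show "log_rate (\<lambda>p. 1 / (2 * real k) * real (N p)) u"
    using log_rate_mult[OF log_rate_const[of "1 / (2 * real k)"] assms(1)] assms(3) by simp
  show "log_rate (\<lambda>p. real (N p)) u" by fact
  have "\<forall>\<^sub>F p in at_right 0. k \<le> N p" using assms(2) by (simp add: filterlim_at_top)
  then show "\<forall>\<^sub>F p in at_right 0. 1 / (2 * real k) * real (N p) \<le> real (N p div k) \<and>
      real (N p div k) \<le> real (N p)"
  proof eventually_elim
    case (elim p)
    \<comment> \<open>Once the quotient is at least 1, the remainder is below k times the quotient,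
      so rounding down loses at most a factor 2.\<close>
    have "1 \<le> N p div k" using elim assms(3) by (simp add: Suc_le_eq div_greater_zero_iff)
    then have "k * 1 \<le> k * (N p div k)" by (rule mult_le_mono2)
    moreover have "N p = k * (N p div k) + N p mod k" by simp
    moreover have "N p mod k < k" using assms(3) by simp
    ultimately have "N p \<le> 2 * k * (N p div k)" by linarith
    then have "real (N p) \<le> 2 * real k * real (N p div k)" by (metis of_nat_le_iff of_nat_mult of_nat_numeral)
    then show ?case using assms(3) by (auto simp: field_simps)
  qed
qed

section \<open>The large deviation rate as a minimal peeling cost\<close>

lemma Rect_eq_Times: "Rect N M = {..<N} \<times> {..<M}"
  by (auto simp: Rect_def)

lemma span_prob_eq_rprob: "span_prob (Rect a b) N M p = rprob p ({..<N} \<times> {..<M}) (peels a b)"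
proof -
  have "span_prob (Rect a b) N M p = rprob p ({..<N} \<times> {..<M}) (spans (Rect a b))"
    by (simp add: span_prob_def rprob_def Rect_eq_Times card_cartesian_product)
  also have "\<dots> = rprob p ({..<N} \<times> {..<M}) (peels a b)"
  proof (rule rprob_cong)
    fix S assume "S \<subseteq> {..<N} \<times> {..<M}"
    then have "finite S" by (rule finite_subset) simp
    then show "spans (Rect a b) S \<longleftrightarrow> peels a b S" by (rule spans_iff_peels)
  qed
  finally show ?thesis .
qed

lemma span_prob_swap: "span_prob (Rect a b) N M p = span_prob (Rect b a) M N p"
  unfolding span_prob_eq_rprob by (subst rprob_swap) (simp add: peels_swap_iff)

lemma has_rate_swap:
  assumes "has_rate \<alpha> \<beta> (Rect a b) v" shows "has_rate \<beta> \<alpha> (Rect b a) v"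
  unfolding has_rate_def
proof (intro allI impI, elim conjE)
  fix N M :: "real \<Rightarrow> nat"
  assume "filterlim N at_top (at_right 0)" "filterlim M at_top (at_right 0)"
    "((\<lambda>p. ln (real (N p)) / ln p) \<longlongrightarrow> - \<beta>) (at_right 0)"
    "((\<lambda>p. ln (real (M p)) / ln p) \<longlongrightarrow> - \<alpha>) (at_right 0)"
  then have "((\<lambda>p. ln (span_prob (Rect a b) (M p) (N p) p) / ln p) \<longlongrightarrow> v) (at_right 0)"
    using assms unfolding has_rate_def by blast
  then show "((\<lambda>p. ln (span_prob (Rect b a) (N p) (M p) p) / ln p) \<longlongrightarrow> v) (at_right 0)"
    by (simp only: span_prob_swap[of b a])
qed

lemma has_rate_peel_cost:
  fixes \<alpha> \<beta> :: real
  assumes "\<alpha> < 1" "\<beta> < 1" "1 \<le> a"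
  shows "has_rate \<alpha> \<beta> (Rect a b) (peel_cost (\<lambda>i. max 0 ((1 - \<alpha>) * real i - \<beta>))
    (\<lambda>j. max 0 ((1 - \<beta>) * real j - \<alpha>)) a b)"
    (is "has_rate _ _ _ (peel_cost ?r ?c a b)")
  unfolding has_rate_def
proof (intro allI impI, elim conjE)
  fix N M :: "real \<Rightarrow> nat"
  assume N: "filterlim N at_top (at_right 0)" and M: "filterlim M at_top (at_right 0)"
    and "((\<lambda>p. ln (real (N p)) / ln p) \<longlongrightarrow> - \<alpha>) (at_right 0)"
    and "((\<lambda>p. ln (real (M p)) / ln p) \<longlongrightarrow> - \<beta>) (at_right 0)"
  moreover have "\<forall>\<^sub>F p in at_right 0. 1 \<le> N p" "\<forall>\<^sub>F p in at_right 0. 1 \<le> M p"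
    using N M by (simp_all add: filterlim_at_top)
  ultimately have rates: "log_rate (\<lambda>p. real (N p)) (- \<alpha>)" "log_rate (\<lambda>p. real (M p)) (- \<beta>)"
    by (auto simp: log_rate_def Suc_le_eq)
  \<comment> \<open>A peeling has at most a + b steps; this is the side length left to each if all
    of them get disjoint blocks.\<close>
  define n m where "n p = N p div (a + b)" and "m p = M p div (a + b)" for p
  have rates': "log_rate (\<lambda>p. real (n p)) (- \<alpha>)" "log_rate (\<lambda>p. real (m p)) (- \<beta>)"
    unfolding n_def m_def using assms by (auto intro!: log_rate_div rates N M)
  \<comment> \<open>One computation serves rows and columns in both bounds; s and t absorb the
    constants 1/i and 1/2 of the lower bound and are 1 in the upper bound.\<close>
  have line: "log_rate (\<lambda>p. min 1 (real (g p) * (real (f p) * p * s) ^ k * t)) (max 0 ((1 - x) * real k - y))"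
    if "log_rate (\<lambda>p. real (f p)) (- x)" "log_rate (\<lambda>p. real (g p)) (- y)" "0 < s" "0 < t"
    for f g x y s t k
  proof -
    have "log_rate (\<lambda>p. real (f p) * p * s) (- x + 1 + 0)"
      by (intro log_rate_mult log_rate_id log_rate_const that)
    from log_rate_power[OF this, of k]
    have "log_rate (\<lambda>p. real (g p) * (real (f p) * p * s) ^ k * t) (- y + real k * (- x + 1 + 0) + 0)"
      by (intro log_rate_mult log_rate_const that)
    from log_rate_min_1[OF this] show ?thesis by (simp add: algebra_simps)
  qed
  define R C where "R p i = min 1 (real (M p) * (real (N p) * p) ^ i)"
    and "C p j = min 1 (real (N p) * (real (M p) * p) ^ j)" for p i j
  have upper: "log_rate (\<lambda>p. upper_rec (R p) (C p) a b) (peel_cost ?r ?c a b)"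
  proof (rule log_rate_upper_rec)
    show "log_rate (\<lambda>p. R p (Suc i)) (?r (Suc i))" for i
      using line[OF rates, of 1 1 "Suc i"] by (simp add: R_def)
    show "log_rate (\<lambda>p. C p (Suc j)) (?c (Suc j))" for j
      using line[OF rates(2,1), of 1 1 "Suc j"] by (simp add: C_def)
  qed
  define R' C' where "R' p i = min 1 (real (m p) * ((real (n p) * p / real i) ^ i / 2)) / 2"
    and "C' p j = min 1 (real (n p) * ((real (m p) * p / real j) ^ j / 2)) / 2" for p i j
  have lower: "log_rate (\<lambda>p. lower_rec (R' p) (C' p) a b) (peel_cost ?r ?c a b)"
  proof (rule log_rate_lower_rec)
    show "log_rate (\<lambda>p. R' p (Suc i)) (?r (Suc i))" for i
      using log_rate_mult[OF log_rate_const[of "1 / 2"] line[OF rates', of "1 / real (Suc i)" "1 / 2" "Suc i"]]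
      by (simp add: R'_def del: of_nat_Suc power_Suc)
    show "log_rate (\<lambda>p. C' p (Suc j)) (?c (Suc j))" for j
      using log_rate_mult[OF log_rate_const[of "1 / 2"] line[OF rates'(2,1), of "1 / real (Suc j)" "1 / 2" "Suc j"]]
      by (simp add: C'_def del: of_nat_Suc power_Suc)
  qed
  \<comment> \<open>Here \<alpha>, \<beta> < 1 enter: the expected number of points on a line of a
    block tends to 0, as the binomial lower bound requires.\<close>
  have "log_rate (\<lambda>p. real (n p) * p) (- \<alpha> + 1)" "log_rate (\<lambda>p. real (m p) * p) (- \<beta> + 1)"
    by (intro log_rate_mult log_rate_id rates')+
  then have small: "\<forall>\<^sub>F p in at_right 0. real (n p) * p < 1 / 2" "\<forall>\<^sub>F p in at_right 0. real (m p) * p < 1 / 2"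
    using assms log_rate_pos_imp_less[of _ _ "1 / 2"] by fastforce+
  have "\<forall>\<^sub>F p in at_right 0. a * (a + b) \<le> N p" "\<forall>\<^sub>F p in at_right 0. b * (a + b) \<le> M p"
    using N M by (simp_all add: filterlim_at_top)
  then have large: "\<forall>\<^sub>F p in at_right 0. a \<le> n p" "\<forall>\<^sub>F p in at_right 0. b \<le> m p"
    using assms by (auto simp: n_def m_def less_eq_div_iff_mult_less_eq elim!: eventually_mono)
  have "log_rate (\<lambda>p. span_prob (Rect a b) (N p) (M p) p) (peel_cost ?r ?c a b)"
  proof (rule log_rate_sandwich[OF lower upper])
    show "\<forall>\<^sub>F p in at_right 0. lower_rec (R' p) (C' p) a b \<le> span_prob (Rect a b) (N p) (M p) p \<and>
        span_prob (Rect a b) (N p) (M p) p \<le> upper_rec (R p) (C p) a b"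
      using small large eventually_at_right_0_1
    proof eventually_elim
      case (elim p)
      have "lower_rec (R' p) (C' p) a b \<le> rprob p ({..<N p} \<times> {..<M p}) (peels a b)"
        unfolding R'_def[abs_def] C'_def[abs_def]
        by (rule rprob_peels_ge[where a = a and b = b]) (use elim in \<open>auto simp: n_def m_def\<close>)
      moreover have "rprob p ({..<N p} \<times> {..<M p}) (peels a b) \<le> upper_rec (R p) (C p) a b"
        using rprob_peels_le[of "{..<N p}" "{..<M p}" p a b] elim by (simp add: R_def[abs_def] C_def[abs_def])
      ultimately show ?case by (simp add: span_prob_eq_rprob)
    qed
  qed
  then show "((\<lambda>p. ln (span_prob (Rect a b) (N p) (M p) p) / ln p) \<longlongrightarrow> peel_cost ?r ?c a b) (at_right 0)"
    by (simp add: log_rate_def)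
qed

section \<open>The minimal peeling cost in closed form\<close>

lemma peel_cost_nonneg:
  assumes "\<And>i. 0 \<le> r i" "\<And>j. 0 \<le> c j" shows "0 \<le> peel_cost r c i j"
  using assms by (induction r c i j rule: peel_cost.induct) auto

text \<open>If i is at most \<open>A\<close>, removing rows only keeps i fixed and costs nothing
  while j runs down to 0; symmetrically for columns. Besides the degenerate case of the theorem,
  this supplies the boundary values of the closed form.\<close>

lemma peel_cost_eq_0:
  assumes nonneg: "\<And>i. 0 \<le> r i" "\<And>j. 0 \<le> c j"
    and free: "\<And>i. i \<le> A \<Longrightarrow> r i = 0" "\<And>j. j \<le> B \<Longrightarrow> c j = 0"
    and "i \<le> A \<or> j \<le> B"
  shows "peel_cost r c i j = 0"
  using assms
proof (induction r c i j rule: peel_cost.induct)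
  case (3 r c i j)
  have "0 \<le> peel_cost r c (Suc i) j" "0 \<le> peel_cost r c i (Suc j)"
    using 3 by (auto intro: peel_cost_nonneg)
  moreover have "0 \<le> r (Suc i)" "0 \<le> c (Suc j)" using 3 by auto
  moreover have "peel_cost r c (Suc i) j = 0 \<and> r (Suc i) = 0 \<or> peel_cost r c i (Suc j) = 0 \<and> c (Suc j) = 0"
  proof (cases "Suc i \<le> A")
    case True
    then have "peel_cost r c (Suc i) j = 0" by (intro "3.IH"(1)) (use 3 in auto)
    then show ?thesis using True 3 by auto
  next
    case False
    then have "Suc j \<le> B" using 3 by simp
    moreover then have "peel_cost r c i (Suc j) = 0" by (intro "3.IH"(2)) (use 3 in auto)
    ultimately show ?thesis using 3 by auto
  qed
  ultimately show ?case by (auto simp: min_def)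
qed auto

text \<open>Beyond the free levels \<open>A\<close>, \<open>B\<close> the costs are affine with slopes \<open>x \<le> y\<close>. Exchanging a
  column followed by a row for a row followed by a column then never hurts, so rows are filled
  first, except that the last row may be better replaced by columns at cost \<open>\<gamma>\<close> each.\<close>

lemma peel_cost_closed_form:
  fixes x y \<rho> \<gamma> :: real
  assumes nonneg: "\<And>i. 0 \<le> r i" "\<And>j. 0 \<le> c j"
    and free: "\<And>i. i \<le> A \<Longrightarrow> r i = 0" "\<And>j. j \<le> B \<Longrightarrow> c j = 0"
    and affine: "\<And>s. r (Suc (A + s)) = \<rho> + x * real s" "\<And>t. c (Suc (B + t)) = \<gamma> + y * real t"
    and slopes: "0 \<le> \<rho>" "\<rho> \<le> x" "x \<le> y"
  shows "peel_cost r c (Suc (A + s)) (Suc (B + t)) =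
    min \<rho> \<gamma> + real s * min \<gamma> x + real t * \<rho> + x * real s * real t"
proof (induction s arbitrary: t)
  case 0
  have free_row: "peel_cost r c A j = 0" for j
    by (rule peel_cost_eq_0[OF nonneg free]) auto
  show ?case
  proof (induction t)
    case 0
    have "peel_cost r c (Suc A) B = 0"
      by (rule peel_cost_eq_0[OF nonneg free]) auto
    then show ?case using affine[of 0] free_row by simp
  next
    case (Suc t)
    have "peel_cost r c (Suc (A + 0)) (Suc (B + Suc t)) =
        min (\<rho> + (min \<rho> \<gamma> + real t * \<rho>)) (\<gamma> + y * real (Suc t))"
      using Suc affine(1)[of 0] affine(2)[of "Suc t"] free_row by simp
    \<comment> \<open>By \<rho> \<le> x \<le> y the row branch wins: all its rows together cost no
      more than the single column.\<close>
    moreover have "real (Suc t) * \<rho> \<le> real (Suc t) * y"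
      using slopes by (intro mult_left_mono) auto
    ultimately show ?case by (auto simp: min_def algebra_simps)
  qed
next
  case (Suc s)
  note column = Suc.IH
  show ?case
  proof (induction t)
    case 0
    have "peel_cost r c (Suc (A + Suc s)) B = 0"
      by (rule peel_cost_eq_0[OF nonneg free]) auto
    then have "peel_cost r c (Suc (A + Suc s)) (Suc (B + 0)) =
        min (\<rho> + x * real (Suc s)) (\<gamma> + (min \<rho> \<gamma> + real s * min \<gamma> x))"
      using column[of 0] affine(1)[of "Suc s"] affine(2)[of 0] by simp
    \<comment> \<open>One row above the free level is left: it is bought outright, or replaced by
      columns at \<gamma> each. If \<gamma> > x, then \<rho> \<le> x < \<gamma> settles the corner
      term as well.\<close>
    also have "\<dots> = min \<rho> \<gamma> + real (Suc s) * min \<gamma> x"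
    proof (cases "\<gamma> \<le> x")
      case True
      then have "real (Suc s) * \<gamma> \<le> real (Suc s) * x" by (intro mult_left_mono) auto
      then show ?thesis using True by (auto simp: min_def algebra_simps)
    next
      case False
      then show ?thesis using slopes by (auto simp: min_def algebra_simps)
    qed
    finally show ?case by simp
  next
    case (Suc t)
    have "peel_cost r c (Suc (A + Suc s)) (Suc (B + Suc t)) =
        min (\<rho> + x * real (Suc s) + (min \<rho> \<gamma> + real (Suc s) * min \<gamma> x + real t * \<rho> + x * real (Suc s) * real t))
          (\<gamma> + y * real (Suc t) + (min \<rho> \<gamma> + real s * min \<gamma> x + real (Suc t) * \<rho> + x * real s * real (Suc t)))"
      using Suc column[of "Suc t"] affine(1)[of "Suc s"] affine(2)[of "Suc t"] by simp
    \<comment> \<open>The column branch exceeds the row branch by exactly (y - x)(t + 1) + (\<gamma>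
      - min \<gamma> x), which is non-negative.\<close>
    moreover have "x * real (Suc t) \<le> y * real (Suc t)"
      using slopes by (intro mult_right_mono) auto
    moreover have "min \<gamma> x \<le> \<gamma>" by simp
    ultimately show ?case by (simp add: algebra_simps min_absorb1)
  qed
qed

text \<open>\<open>D\<close> is the largest level i with (1 - u) i \<le> v. The next level pays only
  the overshoot, which is at most one slope, and from there on the cost is affine. The lemma serves
  rows and, with the two exponents exchanged, columns.\<close>

lemma floor_cost:
  fixes u v :: real
  assumes "0 \<le> u" "u < 1" "0 \<le> v"
  defines "D \<equiv> nat \<lfloor>v / (1 - u)\<rfloor>" and "r \<equiv> \<lambda>i. max 0 ((1 - u) * real i - v)"
  shows "real_of_int \<lfloor>v / (1 - u)\<rfloor> = real D"
    and "i \<le> D \<Longrightarrow> r i = 0"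
    and "r (Suc (D + s)) = ((1 - u) * (real D + 1) - v) + (1 - u) * real s"
    and "0 \<le> (1 - u) * (real D + 1) - v"
    and "(1 - u) * (real D + 1) - v \<le> 1 - u"
proof -
  have "0 \<le> \<lfloor>v / (1 - u)\<rfloor>" using assms by simp
  then show D: "real_of_int \<lfloor>v / (1 - u)\<rfloor> = real D" by (simp add: D_def)
  have "real D \<le> v / (1 - u)" unfolding D[symmetric] by simp
  then have le: "real D * (1 - u) \<le> v" using assms(2) by (simp add: pos_le_divide_eq)
  have "v / (1 - u) < real D + 1" unfolding D[symmetric] by linarith
  then have gt: "v < (real D + 1) * (1 - u)" using assms(2) by (simp add: pos_divide_less_eq)
  show "0 \<le> (1 - u) * (real D + 1) - v" "(1 - u) * (real D + 1) - v \<le> 1 - u"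
    using le gt by (simp_all add: algebra_simps)
  show "r i = 0" if "i \<le> D"
  proof -
    have "(1 - u) * real i \<le> (1 - u) * real D" using that assms(2) by (intro mult_left_mono) simp_all
    then show ?thesis using le by (simp add: r_def algebra_simps)
  qed
  have "0 \<le> (1 - u) * real s" using assms(2) by simp
  then show "r (Suc (D + s)) = ((1 - u) * (real D + 1) - v) + (1 - u) * real s"
    using gt unfolding r_def by (simp add: algebra_simps)
qed

lemma peel_cost_thresholds:
  fixes a b :: nat and \<alpha> \<beta> :: real
  assumes bounds: "0 \<le> \<alpha>" "\<alpha> < 1" "0 \<le> \<beta>" "\<beta> < 1"
  defines "da \<equiv> real_of_int \<lfloor>\<beta> / (1 - \<alpha>)\<rfloor>" and "db \<equiv> real_of_int \<lfloor>\<alpha> / (1 - \<beta>)\<rfloor>"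
  defines "V \<equiv> peel_cost (\<lambda>i. max 0 ((1 - \<alpha>) * real i - \<beta>)) (\<lambda>j. max 0 ((1 - \<beta>) * real j - \<alpha>)) a b"
    and "\<rho> \<equiv> (1 - \<alpha>) * (da + 1) - \<beta>" and "\<gamma> \<equiv> (1 - \<beta>) * (db + 1) - \<alpha>"
  shows "real b \<le> db \<or> real a \<le> da \<Longrightarrow> V = 0"
    and "db < real b \<Longrightarrow> da < real a \<Longrightarrow> \<beta> \<le> \<alpha> \<Longrightarrow>
      V = min \<rho> \<gamma> + (real a - da - 1) * min \<gamma> (1 - \<alpha>) + (real b - db - 1) * \<rho> +
        (1 - \<alpha>) * (real a - da - 1) * (real b - db - 1)"
    and "\<rho> \<le> 1 - \<alpha>"
proof -
  define A B where "A = nat \<lfloor>\<beta> / (1 - \<alpha>)\<rfloor>" and "B = nat \<lfloor>\<alpha> / (1 - \<beta>)\<rfloor>"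
  note row = floor_cost[OF bounds(1-3), folded A_def]
  note column = floor_cost[OF bounds(3,4,1), folded B_def]
  have da: "da = real A" and db: "db = real B" using row(1) column(1) by (simp_all add: da_def db_def)
  show "\<rho> \<le> 1 - \<alpha>" using row(5) by (simp add: \<rho>_def da)
  show "V = 0" if "real b \<le> db \<or> real a \<le> da"
    unfolding V_def
    by (rule peel_cost_eq_0[where A = A and B = B]) (use that row(2) column(2) in \<open>auto simp: da db\<close>)
  assume "db < real b" "da < real a" and le: "\<beta> \<le> \<alpha>"
  \<comment> \<open>The first paid level is one above the free one, hence s = a - \<Delta>a - 1 and
    t = b - \<Delta>b - 1.\<close>
  then obtain s t where s: "a = Suc (A + s)" and t: "b = Suc (B + t)"
    using less_imp_Suc_add[of A a] less_imp_Suc_add[of B b] by (auto simp: da db)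
  have "V = min \<rho> \<gamma> + real s * min \<gamma> (1 - \<alpha>) + real t * \<rho> + (1 - \<alpha>) * real s * real t"
    unfolding V_def s t
  proof (rule peel_cost_closed_form[where y = "1 - \<beta>"])
    show "max 0 ((1 - \<alpha>) * real (Suc (A + s)) - \<beta>) = \<rho> + (1 - \<alpha>) * real s" for s
      using row(3)[of s] by (simp add: \<rho>_def da)
    show "max 0 ((1 - \<beta>) * real (Suc (B + t)) - \<alpha>) = \<gamma> + (1 - \<beta>) * real t" for t
      using column(3)[of t] by (simp add: \<gamma>_def db)
    show "0 \<le> \<rho>" "\<rho> \<le> 1 - \<alpha>" using row(4,5) by (simp_all add: \<rho>_def da)
  qed (use row(2) column(2) le in auto)
  moreover have "real a - da - 1 = real s" "real b - db - 1 = real t" by (simp_all add: s t da db)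
  ultimately show "V = min \<rho> \<gamma> + (real a - da - 1) * min \<gamma> (1 - \<alpha>) + (real b - db - 1) * \<rho> +
        (1 - \<alpha>) * (real a - da - 1) * (real b - db - 1)" by simp
qed

section \<open>Translation into the stated formulas\<close>

lemma closed_form_cheap_corner:
  fixes a b da db \<alpha> \<beta> :: real
  assumes "db * (1 - \<beta>) \<le> \<beta>"
  defines "\<rho> \<equiv> (1 - \<alpha>) * (da + 1) - \<beta>" and "\<gamma> \<equiv> (1 - \<beta>) * (db + 1) - \<alpha>"
  shows "min \<rho> \<gamma> + (a - da - 1) * min \<gamma> (1 - \<alpha>) + (b - db - 1) * \<rho> + (1 - \<alpha>) * (a - da - 1) * (b - db - 1) =
    (1 - \<alpha>) * a * b + ((\<alpha> - \<beta>) * db - \<beta>) * a - \<beta> * b - (1 - \<beta>) * da * db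
           + \<beta> * da + \<beta> * db + \<beta> - max ((1 - \<beta>) * db) ((1 - \<alpha>) * da)"
proof -
  \<comment> \<open>The case condition says precisely that \<gamma> \<le> 1 - \<alpha>, so the last
    row is better replaced by columns.\<close>
  have min_slope: "min \<gamma> (1 - \<alpha>) = \<gamma>" using assms(1) by (simp add: \<gamma>_def algebra_simps)
  \<comment> \<open>Both \<rho> and \<gamma> have the offset 1 - \<alpha> - \<beta>, added to (1 -
    \<alpha>) \<Delta>a and (1 - \<beta>) \<Delta>b respectively; the minimum of the two is their
    sum minus their maximum.\<close>
  have min_corner: "min \<rho> \<gamma> = (1 - \<alpha>) * (da + 1) - \<beta> + (1 - \<beta>) * db - max ((1 - \<beta>) * db) ((1 - \<alpha>) * da)"
    by (auto simp: \<rho>_def \<gamma>_def min_def max_def algebra_simps)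
  show ?thesis unfolding min_slope min_corner unfolding \<rho>_def \<gamma>_def by (simp add: algebra_simps)
qed

text \<open>Now \<gamma> > 1 - \<alpha> \<ge> \<rho>, so rows are cheaper throughout. In the formula
  the minimum is attained by the second entry: the first exceeds it by (\<gamma> - \<rho>) +
  (\<gamma> - (1 - \<alpha>))(a - \<Delta>a - 1).\<close>

lemma closed_form_dear_corner:
  fixes a b da db \<alpha> \<beta> :: real
  assumes "db * (1 - \<beta>) > \<beta>" "da + 1 \<le> a"
  defines "\<rho> \<equiv> (1 - \<alpha>) * (da + 1) - \<beta>" and "\<gamma> \<equiv> (1 - \<beta>) * (db + 1) - \<alpha>"
  assumes "\<rho> \<le> 1 - \<alpha>"
  shows "min \<rho> \<gamma> + (a - da - 1) * min \<gamma> (1 - \<alpha>) + (b - db - 1) * \<rho> + (1 - \<alpha>) * (a - da - 1) * (b - db - 1) =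
    (1 - \<alpha>) * a * b + \<alpha> * db * a - \<beta> * b + \<beta> * db
           + min (- \<beta> * (db + 1) * a - (1 - \<beta>) * da * db + \<beta> * da + \<beta> - (1 - \<alpha>) * da)
                 (- db * a)"
proof -
  have slope: "1 - \<alpha> \<le> \<gamma>" using assms(1) by (simp add: \<gamma>_def algebra_simps)
  have "0 \<le> (\<gamma> - \<rho>) + (\<gamma> - (1 - \<alpha>)) * (a - da - 1)"
    using slope assms by (intro add_nonneg_nonneg mult_nonneg_nonneg) auto
  then have "- db * a \<le> - \<beta> * (db + 1) * a - (1 - \<beta>) * da * db + \<beta> * da + \<beta> - (1 - \<alpha>) * da"
    unfolding \<rho>_def \<gamma>_def by (simp add: algebra_simps)
  then have min_rate: "min (- \<beta> * (db + 1) * a - (1 - \<beta>) * da * db + \<beta> * da + \<beta> - (1 - \<alpha>) * da)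
      (- db * a) = - db * a" by (rule min_absorb2)
  have "min \<rho> \<gamma> = \<rho>" "min \<gamma> (1 - \<alpha>) = 1 - \<alpha>" using slope assms by auto
  then show ?thesis unfolding min_rate by (simp add: \<rho>_def algebra_simps)
qed

theorem mainTheorem10:
  fixes a b :: nat and \<alpha> \<beta> :: real
  assumes "a \<ge> 1" "b \<ge> 1" "0 \<le> \<alpha>" "\<alpha> < 1" "0 \<le> \<beta>" "\<beta> < 1"
  defines "da \<equiv> real_of_int \<lfloor>\<beta> / (1 - \<alpha>)\<rfloor>"
      and "db \<equiv> real_of_int \<lfloor>\<alpha> / (1 - \<beta>)\<rfloor>"
  shows "(real b \<le> db \<or> real a \<le> da \<longrightarrow> has_rate \<alpha> \<beta> (Rect a b) 0)
    \<and> (real b > db \<and> real a > da \<and> \<beta> \<le> \<alpha> \<and> db * (1 - \<beta>) \<le> \<beta> \<longrightarrow>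
        has_rate \<alpha> \<beta> (Rect a b)
          ((1 - \<alpha>) * a * b + ((\<alpha> - \<beta>) * db - \<beta>) * a - \<beta> * b - (1 - \<beta>) * da * db
           + \<beta> * da + \<beta> * db + \<beta> - max ((1 - \<beta>) * db) ((1 - \<alpha>) * da)))
    \<and> (real b > db \<and> real a > da \<and> \<beta> \<le> \<alpha> \<and> db * (1 - \<beta>) > \<beta> \<longrightarrow>
        has_rate \<alpha> \<beta> (Rect a b)
          ((1 - \<alpha>) * a * b + \<alpha> * db * a - \<beta> * b + \<beta> * db
           + min (- \<beta> * (db + 1) * a - (1 - \<beta>) * da * db + \<beta> * da + \<beta> - (1 - \<alpha>) * da)
                 (- db * a)))
    \<and> (real b > db \<and> real a > da \<and> \<beta> \<ge> \<alpha> \<longrightarrow>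
        (\<forall>v. has_rate \<alpha> \<beta> (Rect a b) v \<longleftrightarrow> has_rate \<beta> \<alpha> (Rect b a) v))"
proof -
  note bounds = assms(3-6)
  define V where "V = peel_cost (\<lambda>i. max 0 ((1 - \<alpha>) * real i - \<beta>)) (\<lambda>j. max 0 ((1 - \<beta>) * real j - \<alpha>)) a b"
  note cost = peel_cost_thresholds(1,2)[OF bounds, where a = a and b = b, folded da_def db_def V_def]
  have corner: "(1 - \<alpha>) * (da + 1) - \<beta> \<le> 1 - \<alpha>"
    using peel_cost_thresholds(3)[OF bounds] by (simp only: da_def)
  have rate: "has_rate \<alpha> \<beta> (Rect a b) V"
    unfolding V_def by (rule has_rate_peel_cost) (use assms in auto)
  show ?thesis
  proof (intro conjI impI allI, goal_cases)
    case 1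
    then show ?case using rate cost(1) by simp
  next
    case 2
    then show ?case using rate closed_form_cheap_corner[of db \<beta> \<alpha> da a b] by (simp only: cost(2))
  next
    case 3
    \<comment> \<open>Going back to the integers sharpens the strict inequality to
      \<open>da + 1 \<le> a\<close>, which makes the factor a - \<Delta>a - 1 non-negative.\<close>
    then have "real_of_int \<lfloor>\<beta> / (1 - \<alpha>)\<rfloor> < real_of_int (int a)" by (simp add: da_def)
    then have "\<lfloor>\<beta> / (1 - \<alpha>)\<rfloor> + 1 \<le> int a" by (simp only: of_int_less_iff zless_imp_add1_zle)
    then have "real_of_int (\<lfloor>\<beta> / (1 - \<alpha>)\<rfloor> + 1) \<le> real_of_int (int a)" by (simp only: of_int_le_iff)
    then have "da + 1 \<le> real a" by (simp add: da_def)
    then show ?case using 3 rate corner closed_form_dear_corner[of \<beta> db da a \<alpha> b] by (simp only: cost(2))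
  next
    case (4 v)
    \<comment> \<open>Reflection in the diagonal exchanges the two exponents and the two sides, and
      is its own inverse.\<close>
    show ?case using has_rate_swap by blast
  qed
qed

end
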